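(* Let $\mathbb{K}$ be a field of characteristic zero and let $G$ be any graph (loopless, multiple edges allowed) on the vertex set $\{0,1,\dots,n\}$. Then the four $\mathbb{K}$-algebras $\mathcal{B}_G$, $\mathcal{C}_G$, $\mathcal{D}_G$ and $\mathcal{K}_G$ defined below are pairwise isomorphic as (non-filtered) algebras.
   Context: Graphs have finitely many edges, no loops, and may have multiple edges. $\Phi_G$ is the commutative $\mathbb{K}$-algebra generated by variables $\phi_e$, one for each edge $e$ of $G$, with defining relations $\phi_e^2=0$ for every edge $e$. For a vertex $i$ and an edge $e$ put $c_{i,e}=1$ if $e$ joins $i$ to a vertex $j$ with $i<j$, $c_{i,e}=-1$ if $e$ joins $i$ to a vertex $j$ with $i>j$, and $c_{i,e}=0$ if $e$ is not incident to $i$. Put $X_i=\sum_{e} c_{i,e}\phi_e\in\Phi_G$ for $i=0,\dots,n$. $\mathcal{C}_G$ is the subalgebra of $\Phi_G$ generated by $X_1,\dots,X_n$. Put $Y_i=\exp(X_i)=\prod_{e}(1+c_{i,e}\phi_e)$ for $i=0,\dots,n$; $\mathcal{K}_G$ is the subalgebra of $\Phi_G$ generated by $1,Y_0,\dots,Y_n$. For a set $I$ of vertices, $D_I$ denotes the number of edges of $G$ with exactly one endpoint in $I$. $\mathcal{J}_G\subset\mathbb{K}[x_1,\dots,x_n]$ is the ideal generated by $\left(\sum_{i\in I}x_i\right)^{D_I+1}$ for all nonempty $I\subseteq\{1,\dots,n\}$, and $\mathcal{B}_G=\mathbb{K}[x_1,\dots,x_n]/\mathcal{J}_G$. $\mathcal{I}_G\subset\mathbb{K}[y_0,\dots,y_n]$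 is the ideal generated by $\left(\prod_{i\in I}y_i-1\right)^{D_I+1}$ for all nonempty $I\subseteq\{0,1,\dots,n\}$, and $\mathcal{D}_G=\mathbb{K}[y_0,\dots,y_n]/\mathcal{I}_G$. *)

theory Defs
  imports
    "HOL-Algebra.Module"
    "HOL-Algebra.QuotRing"
    "HOL-Algebra.Subrings"
    "HOL-Library.Poly_Mapping"
begin

section \<open>Algebras over a field\<close>

text \<open>
  The ground field is a type \<open>'k\<close>; an argument \<open>K :: 'k itself\<close> names it.
  A \<open>'k\<close>-algebra is an element of the record type \<open>('k, 'a) module\<close>, i.e. a ring together
  with a scalar multiplication. All algebras, subalgebras and homomorphisms are unital.
\<close>

definition algebra_iso :: "('k, 'a) module \<Rightarrow> ('k, 'b) module \<Rightarrow> ('a \<Rightarrow> 'b) set"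
  where "algebra_iso A B =
    {h \<in> ring_iso A B. \<forall>c. \<forall>a\<in>carrier A. h (c \<odot>\<^bsub>A\<^esub> a) = c \<odot>\<^bsub>B\<^esub> h a}"

definition algebra_isomorphic :: "('k, 'a) module \<Rightarrow> ('k, 'b) module \<Rightarrow> bool"
    (infix \<open>\<cong>\<^sub>a\<^sub>l\<^sub>g\<close> 50)
  where "A \<cong>\<^sub>a\<^sub>l\<^sub>g B \<longleftrightarrow> algebra_iso A B \<noteq> {}"

definition is_subalgebra :: "'a set \<Rightarrow> ('k, 'a) module \<Rightarrow> bool"
  where "is_subalgebra S A \<longleftrightarrow> subring S A \<and> (\<forall>c. \<forall>a\<in>S. c \<odot>\<^bsub>A\<^esub> a \<in> S)"

definition generated_subalgebra :: "('k, 'a) module \<Rightarrow> 'a set \<Rightarrow> ('k, 'a) module"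
  where "generated_subalgebra A X = A\<lparr>carrier := \<Inter>{S. is_subalgebra S A \<and> X \<subseteq> S}\<rparr>"

text \<open>
  The quotient ring \<open>A Quot I\<close>, with scalar multiplication given on cosets by
  \<open>c \<odot> (I + a) = I + c \<odot> a\<close>, written as a union over representatives like \<^const>\<open>rcoset_mult\<close>.
\<close>

definition quotient_algebra :: "('k, 'a) module \<Rightarrow> 'a set \<Rightarrow> ('k, 'a set) module"
  where "quotient_algebra A I =
    \<lparr>carrier = carrier (A Quot I), mult = mult (A Quot I), one = one (A Quot I),
     zero = zero (A Quot I), add = add (A Quot I),
     smult = (\<lambda>c X. \<Union>a\<in>X. I +>\<^bsub>A\<^esub> (c \<odot>\<^bsub>A\<^esub> a))\<rparr>"


section \<open>Polynomial algebras\<close>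

text \<open>
  A monomial is a finitely supported exponent function \<open>'v \<Rightarrow>\<^sub>0 nat\<close>, and a polynomial a finitely
  supported function from monomials to coefficients; the multiplication on this type is
  convolution. The carrier of \<open>poly_algebra K V\<close> only contains the polynomials
  all of whose variables lie in \<open>V\<close>.
\<close>

type_synonym ('v, 'k) mpoly = "('v \<Rightarrow>\<^sub>0 nat) \<Rightarrow>\<^sub>0 'k"

definition var :: "'k::field itself \<Rightarrow> 'v \<Rightarrow> ('v, 'k) mpoly"
  where "var K v = Poly_Mapping.single (Poly_Mapping.single v 1) 1"

definition poly_algebra :: "'k::field itself \<Rightarrow> 'v set \<Rightarrow> ('k, ('v, 'k) mpoly) module"
  where "poly_algebra K V =
    \<lparr>carrier = {p. \<forall>m\<in>Poly_Mapping.keys p. Poly_Mapping.keys m \<subseteq> V},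
     mult = (*), one = 1, zero = 0, add = (+),
     smult = (\<lambda>c p. Poly_Mapping.single 0 c * p)\<rparr>"


section \<open>Graphs\<close>

text \<open>
  A loopless multigraph on the vertex set \<open>{0..n}\<close>: a finite set \<open>E\<close> of edge names, each edge
  being assigned its two-element set of endpoints. Distinct edges may have the same endpoints.
\<close>

definition multigraph :: "nat \<Rightarrow> 'e set \<Rightarrow> ('e \<Rightarrow> nat set) \<Rightarrow> bool"
  where "multigraph n E ends \<longleftrightarrow>
    finite E \<and> (\<forall>e\<in>E. \<exists>i j. i \<le> n \<and> j \<le> n \<and> i \<noteq> j \<and> ends e = {i, j})"

definition edge_sign :: "'k::field itself \<Rightarrow> ('e \<Rightarrow> nat set) \<Rightarrow> nat \<Rightarrow> 'e \<Rightarrow> 'k"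
  where "edge_sign K ends i e =
    (if \<exists>j. ends e = {i, j} \<and> i < j then 1
     else if \<exists>j. ends e = {i, j} \<and> i > j then - 1
     else 0)"

definition cut_size :: "'e set \<Rightarrow> ('e \<Rightarrow> nat set) \<Rightarrow> nat set \<Rightarrow> nat"
  where "cut_size E ends I = card {e \<in> E. card (ends e \<inter> I) = 1}"


section \<open>The algebra of square-free edge variables and its subalgebras\<close>

definition Phi_ideal :: "'k::field itself \<Rightarrow> 'e set \<Rightarrow> ('e, 'k) mpoly set"
  where "Phi_ideal K E = Idl\<^bsub>poly_algebra K E\<^esub> {var K e ^ 2 | e. e \<in> E}"

definition Phi_alg :: "'k::field itself \<Rightarrow> 'e set \<Rightarrow> ('k, ('e, 'k) mpoly set) module"
  where "Phi_alg K E = quotient_algebra (poly_algebra K E) (Phi_ideal K E)"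

definition phi :: "'k::field itself \<Rightarrow> 'e set \<Rightarrow> 'e \<Rightarrow> ('e, 'k) mpoly set"
  where "phi K E e = Phi_ideal K E +>\<^bsub>poly_algebra K E\<^esub> var K e"

definition X_elem :: "'k::field itself \<Rightarrow> 'e set \<Rightarrow> ('e \<Rightarrow> nat set) \<Rightarrow> nat \<Rightarrow> ('e, 'k) mpoly set"
  where "X_elem K E ends i =
    (\<Oplus>\<^bsub>Phi_alg K E\<^esub>e\<in>E. edge_sign K ends i e \<odot>\<^bsub>Phi_alg K E\<^esub> phi K E e)"

text \<open>
  This is the exponential of \<open>X_elem K E ends i\<close>: since \<open>\<phi>\<^sub>e\<^sup>2 = 0\<close>, one has
  \<open>exp (c \<phi>\<^sub>e) = 1 + c \<phi>\<^sub>e\<close>, and the exponential turns the sum over edges into a product.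
\<close>

definition Y_elem :: "'k::field itself \<Rightarrow> 'e set \<Rightarrow> ('e \<Rightarrow> nat set) \<Rightarrow> nat \<Rightarrow> ('e, 'k) mpoly set"
  where "Y_elem K E ends i =
    (\<Otimes>\<^bsub>Phi_alg K E\<^esub>e\<in>E.
       \<one>\<^bsub>Phi_alg K E\<^esub> \<oplus>\<^bsub>Phi_alg K E\<^esub> edge_sign K ends i e \<odot>\<^bsub>Phi_alg K E\<^esub> phi K E e)"

definition C_alg :: "'k::field itself \<Rightarrow> nat \<Rightarrow> 'e set \<Rightarrow> ('e \<Rightarrow> nat set)
    \<Rightarrow> ('k, ('e, 'k) mpoly set) module"
  where "C_alg K n E ends = generated_subalgebra (Phi_alg K E) (X_elem K E ends ` {1..n})"

definition K_alg :: "'k::field itself \<Rightarrow> nat \<Rightarrow> 'e set \<Rightarrow> ('e \<Rightarrow> nat set)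
    \<Rightarrow> ('k, ('e, 'k) mpoly set) module"
  where "K_alg K n E ends =
    generated_subalgebra (Phi_alg K E) (insert \<one>\<^bsub>Phi_alg K E\<^esub> (Y_elem K E ends ` {0..n}))"


section \<open>The algebras given by generators and relations\<close>

definition J_ideal :: "'k::field itself \<Rightarrow> nat \<Rightarrow> 'e set \<Rightarrow> ('e \<Rightarrow> nat set) \<Rightarrow> (nat, 'k) mpoly set"
  where "J_ideal K n E ends = Idl\<^bsub>poly_algebra K {1..n}\<^esub>
    {(\<Sum>i\<in>I. var K i) ^ (cut_size E ends I + 1) | I. I \<noteq> {} \<and> I \<subseteq> {1..n}}"

definition B_alg :: "'k::field itself \<Rightarrow> nat \<Rightarrow> 'e set \<Rightarrow> ('e \<Rightarrow> nat set)
    \<Rightarrow> ('k, (nat, 'k) mpoly set) module"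
  where "B_alg K n E ends = quotient_algebra (poly_algebra K {1..n}) (J_ideal K n E ends)"

definition I_ideal :: "'k::field itself \<Rightarrow> nat \<Rightarrow> 'e set \<Rightarrow> ('e \<Rightarrow> nat set) \<Rightarrow> (nat, 'k) mpoly set"
  where "I_ideal K n E ends = Idl\<^bsub>poly_algebra K {0..n}\<^esub>
    {((\<Prod>i\<in>I. var K i) - 1) ^ (cut_size E ends I + 1) | I. I \<noteq> {} \<and> I \<subseteq> {0..n}}"

definition D_alg :: "'k::field itself \<Rightarrow> nat \<Rightarrow> 'e set \<Rightarrow> ('e \<Rightarrow> nat set)
    \<Rightarrow> ('k, (nat, 'k) mpoly set) module"
  where "D_alg K n E ends = quotient_algebra (poly_algebra K {0..n}) (I_ideal K n E ends)"

end

theory Submission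
  imports Defs "HOL-Computational_Algebra.Polynomial_FPS"
begin

text \<open>
  The elements \<open>X\<^sub>i\<close> and \<open>Y\<^sub>i = exp X\<^sub>i\<close> are nilpotent and unipotent, respectively, and the truncated
  exponential and logarithm express each family polynomially in the other; hence \<open>\<C>\<^sub>G = \<K>\<^sub>G\<close> inside
  \<open>\<Phi>\<^sub>G\<close>, and it remains to compute the kernels of the evaluations \<open>x\<^sub>i \<mapsto> X\<^sub>i\<close> and \<open>y\<^sub>i \<mapsto> Y\<^sub>i\<close>.

  For \<open>x\<^sub>i \<mapsto> X\<^sub>i\<close>, keep all vertices as variables and use the forms \<open>x\<^sub>I = \<Sum>\<^sub>i\<^sub>\<in>\<^sub>I x\<^sub>i\<close> for all finite
  vertex sets \<open>I\<close>. The coefficient of \<open>\<Prod>\<^sub>e\<^sub>\<in>\<^sub>S \<phi>\<^sub>e\<close> in \<open>p(X)\<close> is \<open>(\<Prod>\<^sub>e\<^sub>\<in>\<^sub>S \<partial>\<^sub>e) p (0)\<close>, where \<open>\<partial>\<^sub>e\<close> is the derivative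
  in the direction \<open>v\<^sub>e\<close> of the edge (\<open>v\<^sub>e = \<epsilon>\<^sub>i - \<epsilon>\<^sub>j\<close> if \<open>e\<close> joins \<open>i\<close> and \<open>j\<close>). That all these vanish implies
  \<open>p \<in> J\<^sub>G = (x\<^sub>I\<^bsup>D\<^sub>I + 1\<^esup>)\<close> is shown by deletion and contraction of an edge \<open>e\<close>: by induction \<open>\<partial>\<^sub>e p\<close> lies in
  the ideal of \<open>G - e\<close>; the map \<open>\<partial>\<^sub>e\<close> sends \<open>J\<^sub>G\<close> onto that ideal, so one may assume \<open>\<partial>\<^sub>e p = 0\<close>; then \<open>p\<close> is a
  polynomial on the contracted graph \<open>G/e\<close>, and the induction hypothesis applies again.

  For \<open>y\<^sub>i \<mapsto> Y\<^sub>i\<close>, if \<open>f(Y) = 0\<close> then \<open>f(exp x)\<close> lies in the kernel just computed, and substituting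
  \<open>x\<^sub>i = log y\<^sub>i\<close> turns the generators \<open>x\<^sub>I\<^bsup>D\<^sub>I + 1\<^esup>\<close> into multiples of \<open>(\<Prod>\<^sub>i\<^sub>\<in>\<^sub>I y\<^sub>i - 1)\<^bsup>D\<^sub>I + 1\<^esup>\<close>.
\<close>

section \<open>Substitution homomorphisms\<close>

text \<open>Calculations take place in the full polynomial type, where the ring type classes apply.
  This predicate recovers the carrier of \<open>poly_algebra\<close> when the algebras are
  assembled.\<close>

definition vars_in :: "'v set \<Rightarrow> ('v, 'k::zero) mpoly \<Rightarrow> bool"
  where "vars_in V p \<longleftrightarrow> (\<forall>m\<in>Poly_Mapping.keys p. Poly_Mapping.keys m \<subseteq> V)"

definition const :: "'k::zero \<Rightarrow> ('v, 'k) mpoly"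
  where "const c = Poly_Mapping.single 0 c"

definition indet :: "'v \<Rightarrow> ('v, 'k::zero_neq_one) mpoly"
  where "indet v = Poly_Mapping.single (Poly_Mapping.single v 1) 1"

lemma var_eq_indet [simp]: "var K v = indet v"
  by (simp add: var_def indet_def)

lemma const_0 [simp]: "const 0 = 0"
  and const_1 [simp]: "const (1::'k::comm_ring_1) = 1"
  and const_add: "const (a + b :: 'k) = const a + const b"
  and const_mult: "const (a * b :: 'k) = const a * const b"
  and const_uminus: "const (- a :: 'k) = - const a"
  by (simp_all add: const_def single_add mult_single single_uminus)

lemma vars_in_const [simp]: "vars_in V (const a)"
  by (simp add: vars_in_def const_def)

lemma vars_in_0 [simp]: "vars_in V 0" and vars_in_1 [simp]: "vars_in V (1 :: ('v, 'k::comm_ring_1) mpoly)"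
  by (simp_all add: vars_in_def)

lemma vars_in_indet [simp]: "vars_in V (indet v) \<longleftrightarrow> v \<in> V"
  by (simp add: vars_in_def indet_def)

lemma vars_in_add: "vars_in V p \<Longrightarrow> vars_in V q \<Longrightarrow> vars_in V (p + q)"
  using keys_add[of p q] by (auto simp: vars_in_def)

lemma vars_in_uminus: "vars_in V p \<Longrightarrow> vars_in V (- p :: ('v, 'k::comm_ring_1) mpoly)"
  by (simp add: vars_in_def in_keys_iff)

lemma vars_in_diff:
  "vars_in V p \<Longrightarrow> vars_in V q \<Longrightarrow> vars_in V (p - q :: ('v, 'k::comm_ring_1) mpoly)"
  using vars_in_add[of V p "- q"] vars_in_uminus[of V q] by simp

lemma vars_in_mult:
  assumes "vars_in V p" "vars_in V q"
  shows "vars_in V (p * q :: ('v, 'k::comm_ring_1) mpoly)"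
  unfolding vars_in_def
proof
  fix m assume "m \<in> Poly_Mapping.keys (p * q)"
  then obtain a b where "m = a + b" "a \<in> Poly_Mapping.keys p" "b \<in> Poly_Mapping.keys q"
    using keys_mult[of p q] by auto
  then show "Poly_Mapping.keys m \<subseteq> V"
    using keys_add[of a b] assms by (fastforce simp: vars_in_def)
qed

lemma vars_in_power: "vars_in V p \<Longrightarrow> vars_in V (p ^ k :: ('v, 'k::comm_ring_1) mpoly)"
  by (induction k) (auto intro: vars_in_mult)

lemma vars_in_sum: "(\<And>i. i \<in> S \<Longrightarrow> vars_in V (f i)) \<Longrightarrow> vars_in V (\<Sum>i\<in>S. f i)"
  by (induction S rule: infinite_finite_induct) (auto intro: vars_in_add)

lemma vars_in_prod:
  "(\<And>i. i \<in> S \<Longrightarrow> vars_in V (f i)) \<Longrightarrow> vars_in V (\<Prod>i\<in>S. f i :: ('v, 'k::comm_ring_1) mpoly)"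
  by (induction S rule: infinite_finite_induct) (auto intro: vars_in_mult)

lemmas vars_in_intros = vars_in_add vars_in_uminus vars_in_diff vars_in_mult vars_in_power
  vars_in_sum vars_in_prod

section \<open>Evaluation of polynomials in a commutative ring\<close>

definition monomial_value :: "('v \<Rightarrow> 'r::comm_ring_1) \<Rightarrow> ('v \<Rightarrow>\<^sub>0 nat) \<Rightarrow> 'r"
  where "monomial_value g m = (\<Prod>v\<in>Poly_Mapping.keys m. g v ^ Poly_Mapping.lookup m v)"

lemma monomial_value_superset:
  assumes "finite S" "Poly_Mapping.keys m \<subseteq> S"
  shows "monomial_value g m = (\<Prod>v\<in>S. g v ^ Poly_Mapping.lookup m v)"
  unfolding monomial_value_def using assms
  by (intro prod.mono_neutral_left) (auto simp: in_keys_iff)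

lemma monomial_value_add: "monomial_value g (m + m') = monomial_value g m * monomial_value g m'"
proof -
  let ?S = "Poly_Mapping.keys m \<union> Poly_Mapping.keys m'"
  have "Poly_Mapping.keys (m + m') \<subseteq> ?S" by (rule keys_add)
  then show ?thesis
    by (simp add: monomial_value_superset[of ?S] lookup_add power_add prod.distrib)
qed

lemma monomial_value_0 [simp]: "monomial_value g 0 = 1"
  and monomial_value_single [simp]: "monomial_value g (Poly_Mapping.single v n) = g v ^ n"
  by (simp_all add: monomial_value_def)

lemma mpoly_expand:
  "p = (\<Sum>m\<in>Poly_Mapping.keys p. Poly_Mapping.single m (Poly_Mapping.lookup p m))"
  by (rule poly_mapping_eqI)
     (auto simp: lookup_sum lookup_single when_def in_keys_iff)

text \<open>Evaluation has two targets, polynomials for \<open>msubst\<close> and polynomials in an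
  additional parameter for \<open>mpsubst\<close>; hence the map on scalars is kept
  abstract.\<close>

locale scalar_hom =
  fixes c :: "'k::field \<Rightarrow> 'r::comm_ring_1"
  assumes add: "c (a + b) = c a + c b"
    and mult: "c (a * b) = c a * c b"
    and one: "c 1 = 1"
begin

lemma zero: "c 0 = 0"
  using add[of 0 0] by simp

definition subst :: "('v \<Rightarrow> 'r) \<Rightarrow> ('v, 'k) mpoly \<Rightarrow> 'r"
  where "subst g p =
    (\<Sum>m\<in>Poly_Mapping.keys p. c (Poly_Mapping.lookup p m) * monomial_value g m)"

lemma subst_superset:
  assumes "finite S" "Poly_Mapping.keys p \<subseteq> S"
  shows "subst g p = (\<Sum>m\<in>S. c (Poly_Mapping.lookup p m) * monomial_value g m)"
  unfolding subst_def using assms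
  by (intro sum.mono_neutral_left) (auto simp: in_keys_iff zero)

lemma subst_add: "subst g (p + q) = subst g p + subst g q"
proof -
  let ?S = "Poly_Mapping.keys p \<union> Poly_Mapping.keys q"
  have "Poly_Mapping.keys (p + q) \<subseteq> ?S" by (rule keys_add)
  then show ?thesis
    by (simp add: subst_superset[of ?S] lookup_add add distrib_right sum.distrib)
qed

lemma subst_0: "subst g 0 = 0"
  by (simp add: subst_def)

lemma subst_single: "subst g (Poly_Mapping.single m a) = c a * monomial_value g m"
  by (cases "a = 0") (simp_all add: subst_def zero)

lemma subst_sum: "subst g (\<Sum>i\<in>S. f i) = (\<Sum>i\<in>S. subst g (f i))"
  by (induction S rule: infinite_finite_induct) (simp_all add: subst_add subst_0)

lemma subst_mult: "subst g (p * q) = subst g p * subst g q"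
proof -
  have "subst g (p * q) = subst g (\<Sum>m\<in>Poly_Mapping.keys p. \<Sum>m'\<in>Poly_Mapping.keys q.
      Poly_Mapping.single m (Poly_Mapping.lookup p m) *
      Poly_Mapping.single m' (Poly_Mapping.lookup q m'))"
    using mpoly_expand[of p] mpoly_expand[of q] by (simp add: sum_product[symmetric])
  also have "\<dots> = subst g p * subst g q"
    by (simp add: subst_sum mult_single subst_single subst_def[of g p] subst_def[of g q]
        sum_product mult monomial_value_add ac_simps)
  finally show ?thesis .
qed

lemma subst_const: "subst g (const a) = c a"
  by (simp add: const_def subst_single)

lemma subst_indet: "subst g (indet v) = g v"
  by (simp add: indet_def subst_single one)

lemma subst_1: "subst g 1 = 1"
  using subst_const[of g 1] by (simp add: one)

lemma subst_cong:
  assumes "vars_in V p" "\<And>v. v \<in> V \<Longrightarrow> g v = g' v"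
  shows "subst g p = subst g' p"
  unfolding subst_def monomial_value_def using assms[unfolded vars_in_def]
  by (intro sum.cong refl arg_cong2[where f = "(*)"] prod.cong arg_cong2[where f = "(^)"]) auto

end

lemma single_eq_const_mult_prod:
  fixes a :: "'k::comm_ring_1" and m :: "'v \<Rightarrow>\<^sub>0 nat"
  shows "Poly_Mapping.single m a =
    const a * (\<Prod>v\<in>Poly_Mapping.keys m. indet v ^ Poly_Mapping.lookup m v)"
proof -
  have pw: "(indet v :: ('v,'k) mpoly) ^ k = Poly_Mapping.single (Poly_Mapping.single v k) 1" for v k
    by (induction k) (simp_all add: indet_def mult_single single_add[symmetric])
  have pr: "(\<Prod>v\<in>S. Poly_Mapping.single (f v) (1::'k)) = Poly_Mapping.single (\<Sum>v\<in>S. f v) 1" for S and f :: "'v \<Rightarrow> 'v \<Rightarrow>\<^sub>0 nat"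
    by (induction S rule: infinite_finite_induct) (simp_all add: mult_single)
  have "(\<Sum>v\<in>Poly_Mapping.keys m. Poly_Mapping.single v (Poly_Mapping.lookup m v)) = m"
    by (rule poly_mapping_eqI) (auto simp: lookup_sum lookup_single when_def in_keys_iff)
  then show ?thesis
    by (simp add: pw pr const_def mult_single)
qed

text \<open>Reduces identities between maps governed by sum and product rules to constants and
  variables, so that later proofs avoid monomials.\<close>

lemma mpoly_induct [consumes 1, case_names const indet add mult]:
  fixes p :: "('v, 'k::field) mpoly"
  assumes "vars_in V p"
    and const: "\<And>a. P (const a)"
    and indet: "\<And>v. v \<in> V \<Longrightarrow> P (indet v)"
    and add: "\<And>p q. P p \<Longrightarrow> P q \<Longrightarrow> P (p + q)"
    and mult: "\<And>p q. P p \<Longrightarrow> P q \<Longrightarrow> P (p * q)"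
  shows "P p"
proof -
  have P0: "P 0" and P1: "P 1"
    using const[of 0] const[of 1] by simp_all
  have power: "P (q ^ k)" if "P q" for q k
    by (induction k) (simp_all add: P1 mult that)
  have prod: "P (\<Prod>i\<in>S. f i)" if "\<And>i. i \<in> S \<Longrightarrow> P (f i)" for S and f :: "'v \<Rightarrow> ('v, 'k) mpoly"
    using that by (induction S rule: infinite_finite_induct) (simp_all add: P1 mult)
  have sum: "P (\<Sum>i\<in>S. f i)" if "\<And>i. i \<in> S \<Longrightarrow> P (f i)" for S and f :: "('v \<Rightarrow>\<^sub>0 nat) \<Rightarrow> ('v, 'k) mpoly"
    using that by (induction S rule: infinite_finite_induct) (simp_all add: P0 add)
  have "P (\<Sum>m\<in>Poly_Mapping.keys p. Poly_Mapping.single m (Poly_Mapping.lookup p m))"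
    unfolding single_eq_const_mult_prod using assms(1)[unfolded vars_in_def]
    by (intro sum mult const prod power indet) auto
  then show ?thesis
    using mpoly_expand[of p] by simp
qed

lemma mpoly_full_induct [case_names const indet add mult]:
  fixes p :: "('v, 'k::field) mpoly"
  assumes "\<And>a. P (const a)" "\<And>v. P (indet v)"
    and "\<And>p q. P p \<Longrightarrow> P q \<Longrightarrow> P (p + q)" "\<And>p q. P p \<Longrightarrow> P q \<Longrightarrow> P (p * q)"
  shows "P p"
  by (rule mpoly_induct[of UNIV p]) (simp_all add: assms vars_in_def)


section \<open>Substitution of polynomials for variables\<close>

global_interpretation mp: scalar_hom "const :: 'k::field \<Rightarrow> ('w, 'k) mpoly"
  defines msubst = mp.subst
  by unfold_locales (simp_all add: const_add const_mult)

lemmas msubst_simps [simp] =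
  mp.subst_add mp.subst_mult mp.subst_const mp.subst_indet mp.subst_0 mp.subst_1 mp.subst_sum

lemma msubst_uminus [simp]: "msubst g (- p) = - msubst g p"
  using msubst_simps(1)[of g p "- p"] by (simp add: eq_neg_iff_add_eq_0 add.commute)

lemma msubst_diff [simp]: "msubst g (p - q) = msubst g p - msubst g q"
  using msubst_simps(1)[of g p "- q"] by simp

lemma msubst_power [simp]: "msubst g (p ^ k) = msubst g p ^ k"
  by (induction k) simp_all

lemma msubst_prod [simp]: "msubst g (\<Prod>i\<in>S. f i) = (\<Prod>i\<in>S. msubst g (f i))"
  by (induction S rule: infinite_finite_induct) simp_all

lemma msubst_msubst: "msubst g (msubst h p) = msubst (\<lambda>v. msubst g (h v)) p"
  by (induction p rule: mpoly_full_induct) simp_all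

lemma msubst_id: "msubst indet p = p"
  by (induction p rule: mpoly_full_induct) simp_all

lemma msubst_fixes:
  assumes "vars_in V p" "\<And>v. v \<in> V \<Longrightarrow> g v = indet v"
  shows "msubst g p = p"
  using mp.subst_cong[OF assms] by (simp add: msubst_id)

lemma vars_in_msubst:
  assumes "vars_in V p" "\<And>v. v \<in> V \<Longrightarrow> vars_in W (g v)"
  shows "vars_in W (msubst g p)"
  using assms(1) by (induction rule: mpoly_induct) (simp_all add: vars_in_intros assms(2))


section \<open>Ideals of the full polynomial ring\<close>

text \<open>Adding one multiple of a generator at a time yields an induction rule for following
  additive maps. The link with \<open>Idl\<close> is \<open>genideal_eq\<close>.\<close>

inductive_set idl :: "'r::comm_ring_1 set \<Rightarrow> 'r set" for G
  where
    zero: "0 \<in> idl G"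
  | step: "g \<in> G \<Longrightarrow> a \<in> idl G \<Longrightarrow> r * g + a \<in> idl G"

lemma idl_gen: "g \<in> G \<Longrightarrow> g \<in> idl G"
  using idl.step[OF _ idl.zero, of g G 1] by simp

lemma idl_add [intro]: "a \<in> idl G \<Longrightarrow> b \<in> idl G \<Longrightarrow> a + b \<in> idl G"
  by (induction rule: idl.induct) (auto simp: add.assoc intro: idl.step)

lemma idl_mult_left [intro]: "a \<in> idl G \<Longrightarrow> r * a \<in> idl G"
  by (induction rule: idl.induct)
     (auto simp: distrib_left mult.assoc[symmetric] intro: idl.zero idl.step)

lemma idl_mult_right [intro]: "a \<in> idl G \<Longrightarrow> a * r \<in> idl G"
  using idl_mult_left[of a G r] by (simp add: mult.commute)

lemma idl_uminus [intro]: "a \<in> idl G \<Longrightarrow> - a \<in> idl G"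
  using idl_mult_left[of a G "- 1"] by simp

lemma idl_diff [intro]: "a \<in> idl G \<Longrightarrow> b \<in> idl G \<Longrightarrow> a - b \<in> idl G"
  using idl_add[of a G "- b"] by auto

lemma idl_sum: "(\<And>i. i \<in> S \<Longrightarrow> f i \<in> idl G) \<Longrightarrow> (\<Sum>i\<in>S. f i) \<in> idl G"
  by (induction S rule: infinite_finite_induct) (auto intro: idl.zero)

lemma idl_power_le:
  assumes "a ^ k \<in> idl G" "k \<le> l"
  shows "a ^ l \<in> idl G"
proof -
  have "a ^ l = a ^ (l - k) * a ^ k"
    using assms(2) by (simp add: power_add[symmetric])
  then show ?thesis using assms(1) by auto
qed

text \<open>Only additivity of \<open>h\<close> is assumed, and every multiple \<open>r * g\<close>
  is tested, so that derivations are covered as well as ring homomorphisms.\<close>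

lemma idl_image:
  assumes "a \<in> idl G" "h 0 = 0" "\<And>x y. h (x + y) = h x + h y"
    and "\<And>r g. g \<in> G \<Longrightarrow> h (r * g) \<in> idl G'"
  shows "h a \<in> idl G'"
  using assms(1) by (induction rule: idl.induct) (auto simp: assms intro: idl.zero)

lemma idl_msubst:
  assumes "p \<in> idl G" "\<And>g. g \<in> G \<Longrightarrow> msubst s g \<in> idl G'"
  shows "msubst s p \<in> idl G'"
  using assms(1) by (rule idl_image) (use assms(2) in auto)

lemma idl_subset: "a \<in> idl G \<Longrightarrow> G \<subseteq> idl G' \<Longrightarrow> a \<in> idl G'"
  by (rule idl_image[of a G "\<lambda>x. x"]) auto

lemma idl_minus_cong: "a - b \<in> idl G \<Longrightarrow> a \<in> idl G \<longleftrightarrow> b \<in> idl G"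
  using idl_diff[of a G "a - b"] idl_add[of "a - b" G b] by auto

lemma idl_cong_trans: "a - b \<in> idl G \<Longrightarrow> b - c \<in> idl G \<Longrightarrow> a - c \<in> idl G"
  using idl_add[of "a - b" G "b - c"] by auto

lemma idl_cong_mult:
  assumes "a - b \<in> idl G" "a' - b' \<in> idl G"
  shows "a * a' - b * b' \<in> idl G"
proof -
  have "a * a' - b * b' = (a - b) * a' + b * (a' - b')"
    by (simp add: algebra_simps)
  then show ?thesis using assms by auto
qed

lemma idl_cong_power: "a - b \<in> idl G \<Longrightarrow> a ^ k - b ^ k \<in> idl G"
  by (induction k) (auto intro: idl.zero idl_cong_mult)

lemma idl_cong_prod:
  "(\<And>i. i \<in> S \<Longrightarrow> f i - g i \<in> idl G) \<Longrightarrow> (\<Prod>i\<in>S. f i) - (\<Prod>i\<in>S. g i) \<in> idl G"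
  by (induction S rule: infinite_finite_induct) (auto intro: idl.zero idl_cong_mult)

lemma idl_cong_msubst:
  assumes "vars_in V p" "\<And>v. v \<in> V \<Longrightarrow> g v - h v \<in> idl G"
  shows "msubst g p - msubst h p \<in> idl G"
  using assms(1)
proof (induction rule: mpoly_induct)
  case (add p q)
  then show ?case
    using idl_add[of "msubst g p - msubst h p" G "msubst g q - msubst h q"]
    by (simp add: algebra_simps)
qed (use assms(2) in \<open>auto intro: idl.zero idl_cong_mult\<close>)


section \<open>Directional derivatives\<close>

global_interpretation mpp: scalar_hom "\<lambda>a. [:const a:] :: ('w, 'k::field) mpoly poly"
  defines mpsubst = mpp.subst
  by unfold_locales (simp_all add: const_add const_mult)

text \<open>
  The translate \<open>p(x + t w)\<close> as a polynomial in \<open>t\<close>. It is a ring homomorphism in \<open>p\<close>, so the Leibniz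
  rule for its linear coefficient, the directional derivative, needs no monomial computation.
\<close>

definition translate :: "('v \<Rightarrow> 'k::field) \<Rightarrow> ('v, 'k) mpoly \<Rightarrow> ('v, 'k) mpoly poly"
  where "translate w = mpsubst (\<lambda>v. [:indet v, const (w v):])"

definition ddir :: "('v \<Rightarrow> 'k::field) \<Rightarrow> ('v, 'k) mpoly \<Rightarrow> ('v, 'k) mpoly"
  where "ddir w p = coeff (translate w p) 1"

lemma translate_simps:
  "translate w (p + q) = translate w p + translate w q"
  "translate w (p * q) = translate w p * translate w q"
  "translate w (const a) = [:const a:]"
  "translate w (indet v) = [:indet v, const (w v):]"
  by (simp_all add: translate_def mpp.subst_add mpp.subst_mult mpp.subst_const mpp.subst_indet)

lemma translate_0: "translate w 0 = 0"
  using translate_simps(3)[of w 0] by simp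

lemma coeff_translate_0: "coeff (translate w p) 0 = p"
  by (induction p rule: mpoly_full_induct) (simp_all add: translate_simps coeff_mult)

lemma ddir_add [simp]: "ddir w (p + q) = ddir w p + ddir w q"
  and ddir_mult: "ddir w (p * q) = ddir w p * q + p * ddir w q"
  and ddir_const [simp]: "ddir w (const a) = 0"
  and ddir_indet [simp]: "ddir w (indet v) = const (w v)"
  by (simp_all add: ddir_def translate_simps coeff_mult coeff_translate_0)

lemma ddir_0 [simp]: "ddir w 0 = 0" and ddir_1 [simp]: "ddir w 1 = 0"
  using ddir_const[of w 0] ddir_const[of w 1] by simp_all

lemma ddir_uminus [simp]: "ddir w (- p) = - ddir w p"
  using ddir_add[of w p "- p"] by (simp add: eq_neg_iff_add_eq_0 add.commute)

lemma ddir_diff [simp]: "ddir w (p - q) = ddir w p - ddir w q"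
  using ddir_add[of w p "- q"] by simp

lemma ddir_sum [simp]: "ddir w (\<Sum>i\<in>S. f i) = (\<Sum>i\<in>S. ddir w (f i))"
  by (induction S rule: infinite_finite_induct) simp_all

lemma ddir_const_mult [simp]: "ddir w (const a * p) = const a * ddir w p"
  by (simp add: ddir_mult)

lemma ddir_power_Suc: "ddir w (p ^ Suc k) = of_nat (Suc k) * p ^ k * ddir w p"
  by (induction k) (simp_all add: ddir_mult algebra_simps)

lemma ddir_msubst:
  assumes "\<And>v. ddir w (s v) = const (w' v)"
  shows "ddir w (msubst s p) = msubst s (ddir w' p)"
  by (induction p rule: mpoly_full_induct) (simp_all add: ddir_mult assms)

lemma ddir_nilpotent: "\<exists>k. (ddir w ^^ k) p = 0"
proof (induction p rule: mpoly_full_induct)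
  case (const a)
  show ?case by (rule exI[of _ 1]) simp
next
  case (indet v)
  show ?case by (rule exI[of _ 2]) (simp add: numeral_2_eq_2)
next
  case (add p q)
  then obtain k l where kl: "(ddir w ^^ k) p = 0" "(ddir w ^^ l) q = 0" by blast
  have lin: "(ddir w ^^ i) (a + b) = (ddir w ^^ i) a + (ddir w ^^ i) b" for i a b
    by (induction i) simp_all
  have z: "(ddir w ^^ i) 0 = 0" for i
    by (induction i) simp_all
  have "(ddir w ^^ (k + l)) q = 0" using kl(2) z by (simp add: funpow_add)
  moreover have "(ddir w ^^ (l + k)) p = 0" using kl(1) z by (simp add: funpow_add)
  ultimately show ?case using lin by (metis add.commute add_0)
next
  case (mult p q)
  then obtain k l where kl: "(ddir w ^^ k) p = 0" "(ddir w ^^ l) q = 0" by blast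
  have lin: "(ddir w ^^ i) (a + b) = (ddir w ^^ i) a + (ddir w ^^ i) b" for i a b
    by (induction i) simp_all
  have z: "(ddir w ^^ i) 0 = 0" for i
    by (induction i) simp_all
  \<comment> \<open>The Leibniz rule splits the product into two, in each of which one of the orders
    \<open>k\<close>, \<open>l\<close> has dropped by one; after \<open>k + l\<close> steps every
    term has a zero factor.\<close>
  have "(ddir w ^^ N) (a * b) = 0"
    if "(ddir w ^^ k) a = 0" "(ddir w ^^ l) b = 0" "k + l \<le> N" for N k l a b
    using that
  proof (induction N arbitrary: k l a b)
    case 0
    then show ?case by simp
  next
    case (Suc N)
    show ?case
    proof (cases "k = 0 \<or> l = 0")
      case True
      then have "a * b = 0" using Suc.prems by auto
      then show ?thesis using z by simp
    next
      case False
      then obtain k' l' where [simp]: "k = Suc k'" "l = Suc l'"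
        by (metis not0_implies_Suc)
      have "(ddir w ^^ N) (ddir w a * b) = 0"
        by (rule Suc.IH[of k' _ l]) (use Suc.prems in \<open>auto simp: funpow_Suc_right simp del: funpow.simps\<close>)
      moreover have "(ddir w ^^ N) (a * ddir w b) = 0"
        by (rule Suc.IH[of k _ l']) (use Suc.prems in \<open>auto simp: funpow_Suc_right simp del: funpow.simps\<close>)
      ultimately show ?thesis
        by (simp add: funpow_Suc_right ddir_mult lin del: funpow.simps)
    qed
  qed
  then show ?case using kl by blast
qed

text \<open>Times \<open>z ^ (c - 1)\<close>, the left side is the derivative of
  \<open>z ^ c * h\<close>, so this finds antiderivatives of that form. Local nilpotency makes the
  recursion finite, and characteristic zero allows division by \<open>c\<close>.\<close>

lemma ddir_euler_surj:
  fixes z :: "('v, 'k::field_char_0) mpoly"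
  assumes z: "ddir w z = 1" and "c > 0"
  shows "\<exists>h. of_nat c * h + z * ddir w h = g"
proof -
  have "\<exists>h. of_nat c * h + z * ddir w h = g" if "(ddir w ^^ k) g = 0" "c > 0" for k
    using that
  proof (induction k arbitrary: g c)
    case 0
    then show ?case by (intro exI[of _ 0]) simp
  next
    case (Suc k)
    \<comment> \<open>The choice \<open>h = (g - z * h') / c\<close> has derivative
      \<open>h'\<close> exactly when \<open>h'\<close> solves the equation for \<open>c + 1\<close>
      with right side \<open>ddir w g\<close>.\<close>
    then obtain h' where h': "of_nat (c + 1) * h' + z * ddir w h' = ddir w g"
      using Suc.IH[of "ddir w g" "c + 1"] by (auto simp: funpow_Suc_right simp del: funpow.simps)
    let ?d = "const (inverse (of_nat c)) :: ('v, 'k) mpoly"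
    have "of_nat c = (const (of_nat c) :: ('v, 'k) mpoly)"
      by (simp add: const_def)
    then have dc: "of_nat c * ?d = 1"
      using \<open>c > 0\<close> by (simp add: const_mult[symmetric])
    have "of_nat c * (?d * (g - z * h')) + z * ddir w (?d * (g - z * h'))
        = (of_nat c * ?d) * (g - z * h') + z * ?d * (ddir w g - h' - z * ddir w h')"
      by (simp add: ddir_mult z algebra_simps)
    also have "ddir w g - h' - z * ddir w h' = of_nat c * h'"
      using h' by (simp add: algebra_simps)
    also have "z * ?d * (of_nat c * h') = (of_nat c * ?d) * (z * h')"
      by (simp add: algebra_simps)
    finally show ?case
      unfolding dc by (intro exI[of _ "?d * (g - z * h')"]) (simp add: algebra_simps)
  qed
  then show ?thesis using ddir_nilpotent assms(2) by blast
qed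

text \<open>A linear order on the variables orders the monomials, so that the coefficient ring has
  no zero divisors, as \<open>pderiv\<close> requires.\<close>

lemma pderiv_translate:
  fixes p :: "('v::linorder, 'k::field) mpoly"
  shows "pderiv (translate w p) = translate w (ddir w p)"
  by (induction p rule: mpoly_full_induct)
     (simp_all add: translate_simps translate_0 pderiv_add pderiv_mult ddir_mult pderiv_pCons)

lemma poly_translate: "poly (translate w p) z = msubst (\<lambda>v. indet v + z * const (w v)) p"
  by (induction p rule: mpoly_full_induct) (simp_all add: translate_simps)

text \<open>In characteristic zero, a vanishing derivative in the parameter leaves only the constant
  coefficient of the translate, which is \<open>p\<close>. The parameter may then be any polynomial;
  taking a variable for it later eliminates that variable.\<close>

lemma msubst_translate_kernel:
  fixes p :: "('v::linorder, 'k::field_char_0) mpoly"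
  assumes "ddir w p = 0"
  shows "msubst (\<lambda>v. indet v + z * const (w v)) p = p"
proof -
  have "degree (translate w p) = 0"
    using pderiv_translate[of w p] assms by (simp add: translate_0 pderiv_eq_0_iff)
  then have "translate w p = [:p:]"
    using degree_0_id coeff_translate_0[of w p] by metis
  then show ?thesis
    using poly_translate[of w p z] by simp
qed


section \<open>The power ideal of an oriented multigraph\<close>

definition linform :: "nat set \<Rightarrow> (nat, 'k::field) mpoly"
  where "linform I = (\<Sum>i\<in>I. indet i)"

definition edge_vec :: "nat \<times> nat \<Rightarrow> nat \<Rightarrow> 'k::field"
  where "edge_vec e k = of_bool (k = fst e) - of_bool (k = snd e)"

abbreviation cuts :: "nat set \<Rightarrow> nat \<times> nat \<Rightarrow> bool"
  where "cuts I e \<equiv> (fst e \<in> I) \<noteq> (snd e \<in> I)"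

definition cut_count :: "nat set \<Rightarrow> (nat \<times> nat) list \<Rightarrow> nat"
  where "cut_count I es = length (filter (cuts I) es)"

definition power_gens :: "(nat \<times> nat) list \<Rightarrow> (nat, 'k::field) mpoly set"
  where "power_gens es = {linform I ^ Suc (cut_count I es) | I. finite I}"

text \<open>
  For the list of edge vectors this says that \<open>p\<close> vanishes at the \<open>X\<^sub>i\<close>: the derivatives at the origin
  along the sublists are the coefficients of \<open>p(X)\<close> at the square-free monomials.
\<close>

primrec flat :: "('v \<Rightarrow> 'k::field) list \<Rightarrow> ('v, 'k) mpoly \<Rightarrow> bool"
  where
    "flat [] p \<longleftrightarrow> msubst (\<lambda>_. 0) p = (0 :: ('v, 'k) mpoly)"
  | "flat (w # ws) p \<longleftrightarrow> flat ws p \<and> flat ws (ddir w p)"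

lemma flat_diff: "flat ws p \<Longrightarrow> flat ws q \<Longrightarrow> flat ws (p - q)"
  by (induction ws arbitrary: p q) simp_all

lemma const_eq_0_iff [simp]: "const a = 0 \<longleftrightarrow> a = 0"
  by (metis const_def lookup_single_eq lookup_zero single_zero)

text \<open>The value at the origin is a constant polynomial over the variable type of the target; a
  common scalar lets its vanishing be compared across types.\<close>

lemma constant_term_obtain:
  fixes p :: "('v, 'k::field) mpoly"
  obtains a where "msubst (\<lambda>_. 0) p = (const a :: ('u, 'k) mpoly)"
    "msubst (\<lambda>_. 0) p = (const a :: ('w, 'k) mpoly)"
proof -
  have "\<exists>a. msubst (\<lambda>_. 0) p = (const a :: ('u, 'k) mpoly) \<and>
      msubst (\<lambda>_. 0) p = (const a :: ('w, 'k) mpoly)"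
  proof (induction p rule: mpoly_full_induct)
    case (indet v)
    show ?case by (rule exI[of _ 0]) simp
  qed (auto simp flip: const_add const_mult)
  then show thesis using that by blast
qed

text \<open>Chain rule: \<open>s\<close> fixes the origin and carries the directions
  \<open>ws\<close> to \<open>ws'\<close>. It serves both to pass between edge and vertex variables
  and to contract an edge.\<close>

lemma flat_msubst_iff:
  fixes s :: "'v \<Rightarrow> ('w, 'k::field) mpoly"
  assumes "\<And>v. msubst (\<lambda>_. 0) (s v) = (0 :: ('w, 'k) mpoly)"
    and "list_all2 (\<lambda>w w'. \<forall>v. ddir w (s v) = const (w' v)) ws ws'"
  shows "flat ws (msubst s p) \<longleftrightarrow> flat ws' p"
  using assms(2)
proof (induction arbitrary: p rule: list_all2_induct)
  case Nil
  have "msubst (\<lambda>_. 0) (msubst s p) = (msubst (\<lambda>_. 0) p :: ('w, 'k) mpoly)"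
    by (simp add: msubst_msubst assms(1))
  moreover obtain a where "msubst (\<lambda>_. 0) p = (const a :: ('v, 'k) mpoly)"
      "msubst (\<lambda>_. 0) p = (const a :: ('w, 'k) mpoly)"
    by (rule constant_term_obtain)
  ultimately show ?case by simp
next
  case (Cons w ws w' ws')
  then show ?case by (simp add: ddir_msubst[of w s w'])
qed

lemma ddir_linform:
  "finite I \<Longrightarrow> ddir (edge_vec e) (linform I) = const (of_bool (fst e \<in> I) - of_bool (snd e \<in> I))"
proof -
  assume "finite I"
  have "ddir (edge_vec e) (linform I) = const (\<Sum>i\<in>I. edge_vec e i)"
    unfolding linform_def by (induction I rule: infinite_finite_induct) (simp_all add: const_add)
  also have "(\<Sum>i\<in>I. edge_vec e i) = of_bool (fst e \<in> I) - of_bool (snd e \<in> I)"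
    using \<open>finite I\<close> by (simp add: edge_vec_def sum_subtractf of_bool_def)
  finally show ?thesis .
qed

text \<open>If \<open>e\<close> does not cut \<open>I\<close>, the form is constant along
  \<open>e\<close> and an antiderivative of the coefficient suffices. If it does, the generator for
  the larger graph has one more power, and \<open>ddir_euler_surj\<close> supplies its
  cofactor.\<close>

lemma power_gens_derivative_surj:
  assumes e: "fst e \<noteq> snd e" and "p \<in> idl (power_gens es)"
  shows "\<exists>q \<in> idl (power_gens (e # es)). ddir (edge_vec e) q = (p :: (nat, 'k::field_char_0) mpoly)"
  using assms(2)
proof (induction rule: idl.induct)
  case zero
  show ?case by (rule bexI[OF _ idl.zero]) simp
next
  case (step g a r)
  let ?d = "ddir (edge_vec e :: nat \<Rightarrow> 'k)"
  obtain q where q: "q \<in> idl (power_gens (e # es))" "?d q = a"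
    using step.IH by blast
  obtain I where I: "finite I" and g: "g = linform I ^ Suc (cut_count I es)"
    using step.hyps(1) by (auto simp: power_gens_def)
  have gen: "linform I ^ Suc (cut_count I (e # es)) \<in> idl (power_gens (e # es) :: (nat, 'k) mpoly set)"
    by (rule idl_gen) (use I in \<open>auto simp: power_gens_def\<close>)
  have "\<exists>q' \<in> idl (power_gens (e # es)). ?d q' = r * g"
  proof (cases "cuts I e")
    case False
    then have cc: "cut_count I (e # es) = cut_count I es" and d0: "?d (linform I) = 0"
      by (auto simp: cut_count_def ddir_linform[OF I])
    have z: "?d (indet (fst e)) = 1"
      using e by (simp add: edge_vec_def)
    \<comment> \<open>With factor 1 the left side is the derivative of
      \<open>indet (fst e) * h\<close>, so \<open>r\<close> gets an antiderivative.\<close>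
    obtain h where "of_nat 1 * h + indet (fst e) * ?d h = r"
      using ddir_euler_surj[OF z, of 1 r] by auto
    then have "?d (indet (fst e) * h) = r"
      by (simp add: ddir_mult z del: ddir_indet)
    moreover have "?d g = 0"
      unfolding g ddir_power_Suc d0 by simp
    ultimately have "?d (indet (fst e) * h * g) = r * g"
      by (simp add: ddir_mult[of _ "indet (fst e) * h" g])
    then show ?thesis
      using gen cc g by (metis idl_mult_left)
  next
    case True
    then have cc: "cut_count I (e # es) = Suc (cut_count I es)"
      by (simp add: cut_count_def)
    \<comment> \<open>The sign, 1 or -1, with which \<open>e\<close> crosses the cut; multiplying
      the form by it normalises its derivative to 1.\<close>
    define \<delta> :: "(nat, 'k) mpoly" where "\<delta> = ?d (linform I)"
    have "\<delta> = 1 \<or> \<delta> = - 1"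
      using True unfolding \<delta>_def ddir_linform[OF I] by (auto simp: const_uminus)
    then have dd: "\<delta> * \<delta> = 1" and d\<delta>: "?d \<delta> = 0" by auto
    let ?D = "Suc (cut_count I es)"
    have z: "?d (\<delta> * linform I) = 1"
      by (simp add: ddir_mult d\<delta> flip: \<delta>_def) (rule dd)
    \<comment> \<open>\<open>Suc ?D\<close> is the exponent that differentiating
      \<open>linform I ^ Suc ?D\<close> brings down.\<close>
    obtain h where h: "of_nat (Suc ?D) * h + \<delta> * linform I * ?d h = \<delta> * r"
      using ddir_euler_surj[OF z, of "Suc ?D" "\<delta> * r"] by auto
    have "?d (linform I ^ Suc ?D * h)
        = (of_nat (Suc ?D) * linform I ^ ?D * \<delta>) * h + linform I ^ Suc ?D * ?d h"
      by (simp only: ddir_mult ddir_power_Suc \<delta>_def)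
    also have "\<dots> = linform I ^ ?D * (of_nat (Suc ?D) * \<delta> * h + (\<delta> * \<delta>) * linform I * ?d h)"
      unfolding dd by (simp add: algebra_simps)
    also have "\<dots> = linform I ^ ?D * (\<delta> * (of_nat (Suc ?D) * h + \<delta> * linform I * ?d h))"
      by (simp only: algebra_simps)
    also have "\<dots> = (\<delta> * \<delta>) * (r * g)"
      unfolding h g by (simp only: ac_simps)
    finally have "?d (linform I ^ Suc ?D * h) = r * g"
      unfolding dd by simp
    then show ?thesis
      using gen cc by (metis idl_mult_right)
  qed
  then show ?case using q by (metis ddir_add idl_add)
qed

lemma constant_term_idl:
  assumes "\<And>v. indet v \<in> idl G"
  shows "(p :: ('v, 'k::field) mpoly) - msubst (\<lambda>_. 0) p \<in> idl G"
proof (induction p rule: mpoly_full_induct)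
  case (add p q)
  then show ?case using idl_add[of "p - msubst (\<lambda>_. 0) p" G "q - msubst (\<lambda>_. 0) q"]
    by (simp add: algebra_simps)
qed (auto intro: assms idl.zero idl_cong_mult)

lemma linform_power_in_idl:
  assumes "finite I" "cut_count I es < k"
  shows "linform I ^ k \<in> idl (power_gens es)"
  by (rule idl_power_le[OF idl_gen])
     (use assms in \<open>auto simp: power_gens_def simp del: power_Suc\<close>)

text \<open>Differentiating along an edge lowers the power of a form only if the edge cuts the set,
  and then deleting the edge lowers the required exponent too. The converse uses this to subtract
  elements of the ideal.\<close>

lemma power_ideal_imp_flat:
  fixes p :: "(nat, 'k::field) mpoly"
  assumes "p \<in> idl (power_gens es)"
  shows "flat (map edge_vec es) p"
  using assms
proof (induction es arbitrary: p)
  case Nil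
  have "msubst (\<lambda>_. 0) p \<in> idl ({} :: (nat, 'k) mpoly set)"
    using Nil
  proof (rule idl_msubst)
    fix g :: "(nat, 'k) mpoly" assume "g \<in> power_gens []"
    then have "msubst (\<lambda>_. 0) g = (0 :: (nat, 'k) mpoly)"
      by (auto simp: power_gens_def linform_def)
    then show "msubst (\<lambda>_. 0) g \<in> idl ({} :: (nat, 'k) mpoly set)"
      by (simp add: idl.zero)
  qed
  then have "msubst (\<lambda>_. 0) p = (0 :: (nat, 'k) mpoly)"
    by (cases rule: idl.cases) auto
  then show ?case by simp
next
  case (Cons e es)
  let ?w = "edge_vec e :: nat \<Rightarrow> 'k"
  have "p \<in> idl (power_gens es)"
    using Cons.prems
  proof (rule idl_subset, safe)
    fix g :: "(nat, 'k) mpoly" assume "g \<in> power_gens (e # es)"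
    then obtain I where "finite I" "g = linform I ^ Suc (cut_count I (e # es))"
      by (auto simp: power_gens_def)
    then show "g \<in> idl (power_gens es)"
      using linform_power_in_idl[of I es "Suc (cut_count I (e # es))"]
      by (simp add: cut_count_def split: if_splits)
  qed
  moreover have "ddir ?w p \<in> idl (power_gens es)"
    using Cons.prems
  proof (rule idl_image)
    fix r g :: "(nat, 'k) mpoly" assume "g \<in> power_gens (e # es)"
    then obtain I where I: "finite I" and g: "g = linform I ^ Suc (cut_count I (e # es))"
      by (auto simp: power_gens_def)
    have "g \<in> idl (power_gens es)"
      unfolding g by (rule linform_power_in_idl) (simp_all add: I cut_count_def)
    moreover have "ddir ?w g \<in> idl (power_gens es)"
    proof (cases "cuts I e")
      case True
      then have "linform I ^ cut_count I (e # es) \<in> idl (power_gens es :: (nat, 'k) mpoly set)"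
        by (intro linform_power_in_idl) (simp_all add: I cut_count_def)
      then show ?thesis
        unfolding g ddir_power_Suc by auto
    next
      case False
      then have "ddir ?w (linform I) = 0"
        by (auto simp: ddir_linform[OF I])
      then show ?thesis
        unfolding g ddir_power_Suc by (simp add: idl.zero)
    qed
    ultimately show "ddir ?w (r * g) \<in> idl (power_gens es)"
      by (auto simp: ddir_mult)
  qed simp_all
  ultimately show ?case using Cons.IH by simp
qed

text \<open>The induction is on the number of edges because contraction relabels the remaining
  edges, so that the shorter list is not the tail of the given one.\<close>

theorem flat_imp_power_ideal:
  fixes p :: "(nat, 'k::field_char_0) mpoly"
  assumes "flat (map edge_vec es) p"
  shows "p \<in> idl (power_gens es)"
  using assms
proof (induction "length es" arbitrary: es p rule: less_induct)
  case less
  show ?case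
  proof (cases es)
    case Nil
    have "indet v \<in> idl (power_gens es)" for v :: nat
      using linform_power_in_idl[of "{v}" es 1] Nil
      by (simp add: linform_def cut_count_def)
    then show ?thesis
      using constant_term_idl[of "power_gens es" p] less.prems Nil by auto
  next
    case (Cons e es')
    have fl: "flat (map edge_vec es') p" "flat (map edge_vec es') (ddir (edge_vec e) p)"
      using less.prems Cons by simp_all
    show ?thesis
    proof (cases "fst e = snd e")
      \<comment> \<open>A loop, which contraction makes of a parallel edge, is cut by no set and
        contributes to no exponent.\<close>
      case True
      then have "power_gens es = (power_gens es' :: (nat, 'k) mpoly set)"
        by (simp add: power_gens_def cut_count_def Cons)
      then show ?thesis using less.hyps[OF _ fl(1)] Cons by simp
    next
      case False
      obtain i j where e: "e = (i, j)" by (cases e)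
      let ?w = "edge_vec e :: nat \<Rightarrow> 'k"
      obtain q where q: "q \<in> idl (power_gens es)" "ddir ?w q = ddir ?w p"
        using power_gens_derivative_surj[OF False less.hyps[OF _ fl(2)]] Cons by auto
      define f where "f = p - q"
      \<comment> \<open>Translation along \<open>e\<close> by \<open>indet j\<close>: it sends
        \<open>indet i\<close> to \<open>indet i + indet j\<close> and \<open>indet j\<close> to 0.
        It fixes \<open>f\<close>, whose derivative along \<open>e\<close> vanishes.\<close>
      define \<sigma> where "\<sigma> k = indet k + indet j * const (?w k)" for k
      have f: "msubst \<sigma> f = f"
        using msubst_translate_kernel[of ?w f "indet j"] q(2) by (simp add: f_def \<sigma>_def[abs_def])
      define r where "r k = (if k = j then i else k)" for k
      let ?es = "map (map_prod r r) es'"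
      have "flat (map edge_vec es') (msubst \<sigma> f)"
        using power_ideal_imp_flat[OF q(1)] fl(1) unfolding f by (simp add: f_def Cons flat_diff)
      moreover have "msubst (\<lambda>_. 0) (\<sigma> k) = (0 :: (nat, 'k) mpoly)" for k
        by (simp add: \<sigma>_def)
      \<comment> \<open>Differentiating \<open>\<sigma>\<close> adds the \<open>j\<close> entry of
        an edge vector to the \<open>i\<close> entry and clears the former, which gives the vector
        of the relabelled edge.\<close>
      moreover have "list_all2 (\<lambda>w w'. \<forall>v. ddir w (\<sigma> v) = const (w' v))
          (map edge_vec es') (map edge_vec ?es)"
        using False
        by (auto simp: list_all2_conv_all_nth \<sigma>_def ddir_mult edge_vec_def r_def e
            const_uminus simp flip: const_add const_mult)
      ultimately have "flat (map edge_vec ?es) f"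
        using flat_msubst_iff by blast
      then have "f \<in> idl (power_gens ?es)"
        using less.hyps[of ?es f] Cons by simp
      then have "msubst \<sigma> f \<in> idl (power_gens es)"
      proof (rule idl_msubst)
        fix g :: "(nat, 'k) mpoly" assume "g \<in> power_gens ?es"
        then obtain I where I: "finite I" and g: "g = linform I ^ Suc (cut_count I ?es)"
          by (auto simp: power_gens_def)
        \<comment> \<open>The preimage of \<open>I\<close> under contraction: it does not cut
          \<open>e\<close>, and \<open>\<sigma>\<close> carries the form of \<open>I\<close> to that
          of \<open>I'\<close>.\<close>
        define I' where "I' = {k. r k \<in> I}"
        have I'_eq: "I' = (I - {j}) \<union> (if i \<in> I then {j} else {})"
          by (auto simp: I'_def r_def)
        then have fin: "finite I'" using I by simp
        have "cut_count I' es = cut_count I ?es"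
          using False by (auto simp: cut_count_def Cons I'_def e r_def filter_map o_def)
        moreover have "msubst \<sigma> (linform I) = (linform I' :: (nat, 'k) mpoly)"
        proof -
          have "msubst \<sigma> (linform I) = linform I + indet j * const (\<Sum>k\<in>I. ?w k)"
            unfolding linform_def \<sigma>_def using I
            by (induction I) (simp_all add: const_add algebra_simps)
          also have "(\<Sum>k\<in>I. ?w k) = of_bool (i \<in> I) - of_bool (j \<in> I)"
            using I by (simp add: edge_vec_def sum_subtractf of_bool_def e)
          finally have *: "msubst \<sigma> (linform I) =
              linform I + indet j * const (of_bool (i \<in> I) - of_bool (j \<in> I) :: 'k)" .
          have "(linform I :: (nat, 'k) mpoly) = linform (I - {j}) + (if j \<in> I then indet j else 0)"
            using I by (simp add: linform_def sum.remove[of I j] add.commute)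
          moreover have "(linform I' :: (nat, 'k) mpoly) = linform (I - {j}) + (if i \<in> I then indet j else 0)"
            using I by (simp add: linform_def I'_eq sum.insert_remove add.commute)
          ultimately show ?thesis
            unfolding * by (simp add: const_uminus)
        qed
        ultimately show "msubst \<sigma> g \<in> idl (power_gens es)"
          using linform_power_in_idl[of I' es "Suc (cut_count I ?es)"] fin
          unfolding g by simp
      qed
      then show ?thesis
        using q(1) idl_add f by (metis f_def diff_add_cancel)
    qed
  qed
qed


section \<open>Truncated exponential and logarithm\<close>

definition ueval :: "'k::field poly \<Rightarrow> ('v, 'k) mpoly \<Rightarrow> ('v, 'k) mpoly"
  where "ueval p u = poly (map_poly const p) u"

lemma ueval_0 [simp]: "ueval 0 u = 0"
  by (simp add: ueval_def)

lemma ueval_pCons [simp]: "ueval (pCons a p) u = const a + u * ueval p u"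
  by (simp add: ueval_def map_poly_pCons)

lemma ueval_1 [simp]: "ueval 1 u = 1"
  by (simp add: one_pCons)

lemma ueval_add [simp]: "ueval (p + q) u = ueval p u + ueval q u"
  by (induction p q rule: poly_induct2) (simp_all add: const_add algebra_simps)

lemma ueval_uminus [simp]: "ueval (- p) u = - ueval p u"
  using ueval_add[of p "- p" u] by (simp add: eq_neg_iff_add_eq_0 add.commute)

lemma ueval_diff [simp]: "ueval (p - q) u = ueval p u - ueval q u"
  using ueval_add[of p "- q" u] by simp

lemma ueval_smult [simp]: "ueval (smult a p) u = const a * ueval p u"
  by (induction p) (simp_all add: const_mult algebra_simps)

lemma ueval_mult [simp]: "ueval (p * q) u = ueval p u * ueval q u"
  by (induction p) (simp_all add: algebra_simps)

lemma ueval_pcompose: "ueval (pcompose p q) u = ueval p (ueval q u)"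
  by (induction p) (simp_all add: pcompose_pCons)

lemma ueval_sum [simp]: "ueval (\<Sum>i\<in>S. f i) u = (\<Sum>i\<in>S. ueval (f i) u)"
  by (induction S rule: infinite_finite_induct) simp_all

lemma ueval_monom [simp]: "ueval (monom a k) u = const a * u ^ k"
  by (induction k) (simp_all add: monom_Suc monom_0 ac_simps)

lemma msubst_ueval [simp]: "msubst g (ueval p u) = ueval p (msubst g u)"
  by (induction p) simp_all

lemma vars_in_ueval: "vars_in V u \<Longrightarrow> vars_in V (ueval p u)"
  by (induction p) (simp_all add: vars_in_intros)

lemma idl_cong_ueval: "a - b \<in> idl G \<Longrightarrow> ueval p a - ueval p b \<in> idl G"
proof (induction p)
  case (pCons c p)
  then show ?case using idl_cong_mult[of a b G "ueval p a" "ueval p b"] by simp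
qed (simp add: idl.zero)

definition exp_poly :: "nat \<Rightarrow> 'k::field_char_0 poly"
  where "exp_poly N = (\<Sum>k\<le>N. monom (1 / fact k) k)"

text \<open>The series is that of log (1 + t), so the logarithm of a unipotent \<open>y\<close> is
  evaluated at \<open>y - 1\<close>.\<close>

definition log_poly :: "nat \<Rightarrow> 'k::field_char_0 poly"
  where "log_poly N = truncate_fps (Suc N) (fps_ln 1)"

lemma coeff_exp_poly: "coeff (exp_poly N) i = (if i \<le> N then 1 / fact i else 0)"
  by (simp add: exp_poly_def coeff_sum)

lemma coeff_log_poly: "coeff (log_poly N) i = (if i \<le> N then fps_nth (fps_ln 1) i else 0)"
  by (simp add: log_poly_def less_Suc_eq_le)

lemma fps_power_nth_cong:
  assumes "\<And>i. i \<le> n \<Longrightarrow> fps_nth a i = fps_nth b i"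
  shows "i \<le> n \<Longrightarrow> fps_nth (a ^ k) i = fps_nth (b ^ k :: 'k::field fps) i"
  by (induction k arbitrary: i) (auto simp: fps_mult_nth assms intro!: sum.cong)

text \<open>The formula for a coefficient of a composite refers only to coefficients up to the same
  index; hence the formal identities between exponential and logarithm survive truncation.\<close>

lemma fps_compose_nth_cong:
  assumes "\<And>i. i \<le> n \<Longrightarrow> fps_nth a i = fps_nth a' i" "\<And>i. i \<le> n \<Longrightarrow> fps_nth b i = fps_nth b' i"
  shows "fps_nth (a oo b) n = fps_nth (a' oo b' :: 'k::field fps) n"
  using assms fps_power_nth_cong[of n b b'] by (auto simp: fps_compose_nth intro!: sum.cong)

lemma poly_eq_low_coeffs:
  assumes "\<And>i. i \<le> N \<Longrightarrow> coeff p i = coeff (q :: 'k::field poly) i"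
  obtains r where "p = q + monom 1 (Suc N) * r"
proof -
  have "monom 1 (Suc N) dvd p - q"
    using assms by (simp add: monom_1_dvd_iff')
  then show thesis using that by (metis dvdE add.commute diff_add_cancel)
qed

lemma log_exp_poly:
  obtains r :: "'k::field_char_0 poly"
  where "pcompose (log_poly N) (exp_poly N - 1) = [:0, 1:] + monom 1 (Suc N) * r"
proof (rule poly_eq_low_coeffs)
  fix i assume "i \<le> N"
  have "coeff (pcompose (log_poly N) (exp_poly N - 1)) i
      = fps_nth (fps_of_poly (log_poly N) oo fps_of_poly (exp_poly N - 1)) i"
    by (simp add: coeff_exp_poly coeff_log_poly flip: fps_of_poly_pcompose)
  also have "\<dots> = fps_nth (fps_ln 1 oo (fps_exp 1 - 1)) i"
    using \<open>i \<le> N\<close>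
    by (intro fps_compose_nth_cong) (simp_all add: coeff_exp_poly coeff_log_poly fps_of_poly_diff)
  also have "fps_ln 1 oo (fps_exp 1 - 1) = (fps_X :: 'k fps)"
    by (simp add: fps_ln_fps_exp_inv fps_inv)
  finally show "coeff (pcompose (log_poly N) (exp_poly N - 1)) i = coeff [:0, 1 :: 'k:] i"
    by (simp add: coeff_pCons split: nat.splits)
qed

lemma exp_log_poly:
  obtains r :: "'k::field_char_0 poly"
  where "pcompose (exp_poly N) (log_poly N) = [:1, 1:] + monom 1 (Suc N) * r"
proof (rule poly_eq_low_coeffs)
  fix i assume "i \<le> N"
  have "coeff (pcompose (exp_poly N) (log_poly N)) i
      = fps_nth (fps_of_poly (exp_poly N) oo fps_of_poly (log_poly N)) i"
    by (simp add: coeff_exp_poly coeff_log_poly flip: fps_of_poly_pcompose)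
  also have "\<dots> = fps_nth (fps_exp 1 oo fps_ln 1) i"
    using \<open>i \<le> N\<close>
    by (intro fps_compose_nth_cong) (simp_all add: coeff_exp_poly coeff_log_poly)
  also have "fps_exp 1 oo fps_ln 1 = (((fps_exp 1 - 1) oo fps_ln 1) + 1 :: 'k fps)"
    by (simp add: fps_compose_sub_distrib)
  also have "\<dots> = fps_X + 1"
    by (simp add: fps_ln_fps_exp_inv fps_inv_right)
  finally show "coeff (pcompose (exp_poly N) (log_poly N)) i = coeff [:1, 1 :: 'k:] i"
    by (simp add: coeff_pCons split: nat.splits)
qed

lemma log_poly_dvd: obtains r :: "'k::field_char_0 poly" where "log_poly N = [:0, 1:] * r"
proof -
  have "monom 1 1 dvd (log_poly N :: 'k poly)"
    by (simp add: monom_1_dvd_iff' coeff_log_poly)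
  then show thesis using that by (auto simp: monom_altdef)
qed

text \<open>The truncation error is a multiple of \<open>u ^ Suc N\<close>, which lies in the
  ideal.\<close>

lemma ueval_log_exp:
  fixes u :: "('v, 'k::field_char_0) mpoly"
  assumes "u ^ k \<in> idl G" "k \<le> Suc N"
  shows "ueval (log_poly N) (ueval (exp_poly N) u - 1) - u \<in> idl G"
proof -
  obtain r :: "'k poly" where "pcompose (log_poly N) (exp_poly N - 1) = [:0, 1:] + monom 1 (Suc N) * r"
    by (rule log_exp_poly)
  from arg_cong[OF this, of "\<lambda>p. ueval p u"]
  have "ueval (log_poly N) (ueval (exp_poly N) u - 1) = u + u ^ Suc N * ueval r u"
    by (simp add: ueval_pcompose)
  then show ?thesis
    using idl_power_le[OF assms] by auto
qed

lemma ueval_exp_log: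
  fixes u :: "('v, 'k::field_char_0) mpoly"
  assumes "u ^ k \<in> idl G" "k \<le> Suc N"
  shows "ueval (exp_poly N) (ueval (log_poly N) u) - (1 + u) \<in> idl G"
proof -
  obtain r :: "'k poly" where "pcompose (exp_poly N) (log_poly N) = [:1, 1:] + monom 1 (Suc N) * r"
    by (rule exp_log_poly)
  from arg_cong[OF this, of "\<lambda>p. ueval p u"]
  have "ueval (exp_poly N) (ueval (log_poly N) u) = 1 + u + u ^ Suc N * ueval r u"
    by (simp add: ueval_pcompose)
  then show ?thesis
    using idl_power_le[OF assms] by auto
qed

text \<open>Without a constant term, the logarithm is a multiple of \<open>u\<close>. The exponent
  is kept exactly, as the exponents of the generators demand.\<close>

lemma ueval_log_power:
  fixes u :: "('v, 'k::field_char_0) mpoly"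
  assumes "u ^ k \<in> idl G"
  shows "ueval (log_poly N) u ^ k \<in> idl G"
proof -
  obtain r :: "'k poly" where r: "log_poly N = [:0, 1:] * r"
    by (rule log_poly_dvd)
  have "ueval (log_poly N) u = u * ueval r u"
    unfolding r by simp
  then show ?thesis using assms by (auto simp: power_mult_distrib)
qed

lemma ueval_exp_eq: "ueval (exp_poly N) u = (\<Sum>k\<le>N. const (1 / fact k) * u ^ k)"
  by (simp add: exp_poly_def)

section \<open>Nilpotency of sums and the functional equation of the exponential\<close>

lemma nilpotent_add:
  assumes "a ^ p \<in> idl G" "b ^ q \<in> idl G" "p + q \<le> Suc m"
  shows "(a + b) ^ m \<in> idl G"
  unfolding binomial_ring
proof (rule idl_sum)
  fix k assume "k \<in> {..m}"
  then have "p \<le> k \<or> q \<le> m - k" using assms(3) by auto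
  then have "a ^ k \<in> idl G \<or> b ^ (m - k) \<in> idl G"
    using idl_power_le assms by blast
  then show "of_nat (m choose k) * a ^ k * b ^ (m - k) \<in> idl G" by auto
qed

text \<open>Each further summand raises the exponent by \<open>p\<close>. For squares in the ideal,
  \<open>p = 1\<close>, the result is the number of summands plus one, which is where the exponents
  \<open>Suc (D I)\<close> come from.\<close>

lemma nilpotent_sum:
  assumes "finite S" "\<And>i. i \<in> S \<Longrightarrow> f i ^ Suc p \<in> idl G"
  shows "(\<Sum>i\<in>S. f i) ^ Suc (p * card S) \<in> idl G"
  using assms
proof (induction S)
  case empty
  then show ?case by (simp add: idl.zero)
next
  case (insert x S)
  then show ?case
    using nilpotent_add[of "f x" "Suc p" G "\<Sum>i\<in>S. f i" "Suc (p * card S)" "Suc (p * card (insert x S))"]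
    by simp
qed

text \<open>In the product, the triangle \<open>i + j <= N\<close> gives the exponential of the sum
  by the binomial theorem. Outside it \<open>i >= p\<close> or \<open>j >= q\<close>, because
  \<open>p + q <= Suc N\<close>.\<close>

lemma ueval_exp_add:
  fixes a b :: "('v, 'k::field_char_0) mpoly"
  assumes "a ^ p \<in> idl G" "b ^ q \<in> idl G" "p + q \<le> Suc N"
  shows "ueval (exp_poly N) a * ueval (exp_poly N) b - ueval (exp_poly N) (a + b) \<in> idl G"
proof -
  define f where "f i j = const (1 / fact i) * a ^ i * (const (1 / fact j) * b ^ j)" for i j
  have "const (1 / fact k) * (a + b) ^ k = (\<Sum>i\<le>k. f i (k - i))" for k
    unfolding binomial_ring sum_distrib_left
  proof (rule sum.cong)
    fix i assume "i \<in> {..k}"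
    then have "1 / fact k * of_nat (k choose i) = (1 / fact i * (1 / fact (k - i)) :: 'k)"
      by (simp add: binomial_fact)
    then have "const (1 / fact k) * const (of_nat (k choose i))
        = (const (1 / fact i) * const (1 / fact (k - i)) :: ('v, 'k) mpoly)"
      by (simp only: flip: const_mult)
    then have "const (1 / fact k) * of_nat (k choose i)
        = (const (1 / fact i) * const (1 / fact (k - i)) :: ('v, 'k) mpoly)"
      by (simp add: const_def)
    then have "(const (1 / fact k) * of_nat (k choose i)) * (a ^ i * b ^ (k - i))
        = (const (1 / fact i) * const (1 / fact (k - i))) * (a ^ i * b ^ (k - i))"
      by (simp only:)
    then show "const (1 / fact k) * (of_nat (k choose i) * a ^ i * b ^ (k - i)) = f i (k - i)"
      unfolding f_def by (simp only: ac_simps)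
  qed simp
  then have sum: "ueval (exp_poly N) (a + b) = (\<Sum>(i, j)\<in>{(i, j). i + j \<le> N}. f i j)"
    by (simp add: ueval_exp_eq sum.triangle_reindex_eq)
  have "ueval (exp_poly N) a * ueval (exp_poly N) b = (\<Sum>(i, j)\<in>{..N} \<times> {..N}. f i j)"
    by (simp add: ueval_exp_eq f_def sum_product sum.cartesian_product)
  also have "\<dots> = (\<Sum>(i, j)\<in>{..N} \<times> {..N} - {(i, j). i + j \<le> N}. f i j)
      + (\<Sum>(i, j)\<in>{(i, j). i + j \<le> N}. f i j)"
    by (rule sum.subset_diff) auto
  finally have "ueval (exp_poly N) a * ueval (exp_poly N) b - ueval (exp_poly N) (a + b)
      = (\<Sum>(i, j)\<in>{..N} \<times> {..N} - {(i, j). i + j \<le> N}. f i j)"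
    by (simp add: sum)
  also have "\<dots> \<in> idl G"
  proof (rule idl_sum, clarsimp)
    fix i j assume "\<not> i + j \<le> N"
    then have "p \<le> i \<or> q \<le> j" using assms(3) by auto
    then have "a ^ i \<in> idl G \<or> b ^ j \<in> idl G"
      using idl_power_le assms by blast
    then show "f i j \<in> idl G" by (auto simp: f_def)
  qed
  finally show ?thesis .
qed

lemma ueval_exp_0 [simp]: "ueval (exp_poly N) 0 = 1"
  by (simp add: ueval_exp_eq power_0_left if_distrib cong: if_cong)

lemma ueval_exp_sum:
  fixes f :: "'i \<Rightarrow> ('v, 'k::field_char_0) mpoly"
  assumes "finite S" "\<And>i. i \<in> S \<Longrightarrow> f i ^ Suc p \<in> idl G" "p * card S < N"
  shows "(\<Prod>i\<in>S. ueval (exp_poly N) (f i)) - ueval (exp_poly N) (\<Sum>i\<in>S. f i) \<in> idl G"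
  using assms
proof (induction S)
  case empty
  then show ?case by (simp add: idl.zero)
next
  case (insert x S)
  let ?e = "ueval (exp_poly N :: 'k poly)"
  have "?e (f x) * (\<Prod>i\<in>S. ?e (f i)) - ?e (f x) * ?e (\<Sum>i\<in>S. f i) \<in> idl G"
    using insert by (intro idl_cong_mult) (auto intro: idl.zero)
  moreover have "(\<Sum>i\<in>S. f i) ^ Suc (p * card S) \<in> idl G"
    by (rule nilpotent_sum) (use insert in auto)
  \<comment> \<open>The bound \<open>p * card (insert x S) < N\<close> is precisely the condition on
    the exponents in \<open>ueval_exp_add\<close>.\<close>
  then have "?e (f x) * ?e (\<Sum>i\<in>S. f i) - ?e (f x + (\<Sum>i\<in>S. f i)) \<in> idl G"
    using insert.prems insert.hyps by (intro ueval_exp_add[of _ "Suc p" _ _ "Suc (p * card S)"]) auto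
  ultimately show ?case
    using insert.hyps idl_cong_trans by simp
qed

lemma ueval_exp_square_zero:
  fixes b :: "('v, 'k::field_char_0) mpoly"
  assumes "b ^ 2 \<in> idl G" "0 < N"
  shows "ueval (exp_poly N) b - (1 + b) \<in> idl G"
proof -
  have "{..N} = {0, 1} \<union> {2..N}" using assms(2) by auto
  then have "ueval (exp_poly N) b = 1 + b + (\<Sum>k\<in>{2..N}. const (1 / fact k) * b ^ k)"
    by (simp add: ueval_exp_eq add.assoc)
  moreover have "(\<Sum>k\<in>{2..N}. const (1 / fact k) * b ^ k) \<in> idl G"
    using idl_power_le[OF assms(1)] by (intro idl_sum) auto
  ultimately show ?thesis by simp
qed

lemma ueval_exp_minus_1_power:
  fixes u :: "('v, 'k::field_char_0) mpoly"
  assumes "u ^ k \<in> idl G"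
  shows "(ueval (exp_poly N) u - 1) ^ k \<in> idl G"
proof -
  have "monom 1 1 dvd (exp_poly N - 1 :: 'k poly)"
    by (simp add: monom_1_dvd_iff' coeff_exp_poly)
  then obtain r :: "'k poly" where "exp_poly N - 1 = [:0, 1:] * r"
    by (auto simp: monom_altdef)
  from arg_cong[OF this, of "\<lambda>p. ueval p u"]
  have "ueval (exp_poly N) u - 1 = u * ueval r u" by simp
  then show ?thesis using assms by (auto simp: power_mult_distrib)
qed


section \<open>Kernels of the evaluations at the edge algebra\<close>

definition unit_vec :: "'v \<Rightarrow> 'v \<Rightarrow> 'k::field"
  where "unit_vec e k = of_bool (k = e)"

text \<open>Removing \<open>e\<close> from the list replaces the generator
  \<open>indet e ^ 2\<close> by \<open>indet e\<close>; the square and its derivative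
  \<open>2 * indet e\<close> both lie in the new ideal. Distinctness ensures that \<open>e\<close>
  does not recur.\<close>

lemma square_ideal_imp_flat:
  fixes p :: "('e, 'k::field) mpoly"
  assumes "distinct xs"
    and "p \<in> idl ({indet e ^ 2 | e. e \<in> set xs} \<union> {indet e | e. e \<notin> set xs})"
  shows "flat (map unit_vec xs) p"
  using assms
proof (induction xs arbitrary: p)
  case Nil
  have "msubst (\<lambda>_. 0) p \<in> idl ({} :: ('e, 'k) mpoly set)"
    using Nil(2) by (rule idl_msubst) (auto intro: idl.zero)
  then have "msubst (\<lambda>_. 0) p = (0 :: ('e, 'k) mpoly)"
    by (cases rule: idl.cases) auto
  then show ?case by simp
next
  case (Cons e xs)
  let ?G = "\<lambda>xs. {indet e ^ 2 | e. e \<in> set xs} \<union> {indet e | e. e \<notin> set xs} :: ('e, 'k) mpoly set"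
  have e: "indet e \<in> idl (?G xs)"
    using Cons.prems(1) by (intro idl_gen) auto
  have sub: "g \<in> idl (?G xs)" if "g \<in> ?G (e # xs)" for g
  proof (cases "g = indet e ^ 2")
    case True
    then show ?thesis using e by (simp add: power2_eq_square idl_mult_left)
  next
    case False
    then show ?thesis using that by (intro idl_gen) auto
  qed
  have "p \<in> idl (?G xs)"
    using Cons.prems(2) by (rule idl_subset) (use sub in blast)
  moreover have "ddir (unit_vec e) p \<in> idl (?G xs)"
    using Cons.prems(2)
  proof (rule idl_image)
    fix r g assume g: "g \<in> ?G (e # xs)"
    have "ddir (unit_vec e) g \<in> idl (?G xs)"
    proof (cases "g = indet e ^ 2")
      case True
      then have "ddir (unit_vec e) g = 2 * indet e"
        by (simp add: power2_eq_square ddir_mult unit_vec_def)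
      then show ?thesis using e by auto
    next
      case False
      then have "ddir (unit_vec e) g = 0"
        using g by (auto simp: power2_eq_square ddir_mult unit_vec_def)
      then show ?thesis by (simp add: idl.zero)
    qed
    then show "ddir (unit_vec e) (r * g) \<in> idl (?G xs)"
      using sub[OF g] by (auto simp: ddir_mult)
  qed simp_all
  ultimately show ?case using Cons by simp
qed

section \<open>Vertex elements of the edge algebra for an oriented graph\<close>

locale oriented_graph =
  fixes n :: nat and E :: "'e set" and src tgt :: "'e \<Rightarrow> nat"
  assumes finite_E: "finite E"
    and src_le: "e \<in> E \<Longrightarrow> src e \<le> n"
    and tgt_le: "e \<in> E \<Longrightarrow> tgt e \<le> n"
begin

definition sqs :: "('e, 'k::field_char_0) mpoly set"
  where "sqs = {indet e ^ 2 | e. e \<in> E}"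

definition cf :: "nat \<Rightarrow> 'e \<Rightarrow> 'k::field_char_0"
  where "cf i e = edge_vec (src e, tgt e) i"

definition Xp :: "nat \<Rightarrow> ('e, 'k::field_char_0) mpoly"
  where "Xp i = (\<Sum>e\<in>E. const (cf i e) * indet e)"

definition Yp :: "nat \<Rightarrow> ('e, 'k::field_char_0) mpoly"
  where "Yp i = (\<Prod>e\<in>E. 1 + const (cf i e) * indet e)"

definition D :: "nat set \<Rightarrow> nat"
  where "D I = card {e \<in> E. cuts I (src e, tgt e)}"

definition Jgens :: "(nat, 'k::field_char_0) mpoly set"
  where "Jgens = {linform I ^ Suc (D I) | I. I \<noteq> {} \<and> I \<subseteq> {1..n}}"

definition Igens :: "(nat, 'k::field_char_0) mpoly set"
  where "Igens = {((\<Prod>i\<in>I. indet i) - 1) ^ Suc (D I) | I. I \<noteq> {} \<and> I \<subseteq> {0..n}}"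

lemma D_le: "D I \<le> card E"
  unfolding D_def by (rule card_mono[OF finite_E]) auto

lemma D_Int: "D (I \<inter> {0..n}) = D I"
proof -
  have "{e \<in> E. cuts (I \<inter> {0..n}) (src e, tgt e)} = {e \<in> E. cuts I (src e, tgt e)}"
    using src_le tgt_le by auto
  then show ?thesis by (simp only: D_def)
qed

text \<open>A set and its complement have the same cut, which later allows vertex 0 to be
  eliminated.\<close>

lemma D_Compl: "D ({0..n} - I) = D I"
proof -
  have "{e \<in> E. cuts ({0..n} - I) (src e, tgt e)} = {e \<in> E. cuts I (src e, tgt e)}"
    using src_le tgt_le by auto
  then show ?thesis by (simp only: D_def)
qed

lemma edge_square: "e \<in> E \<Longrightarrow> (const a * indet e) ^ 2 \<in> idl sqs"
  unfolding power_mult_distrib by (intro idl_mult_left idl_gen) (auto simp: sqs_def)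

text \<open>The derivative of \<open>Xp i\<close> along the variable of \<open>e\<close> is the
  entry at \<open>i\<close> of the edge vector, so the chain rule turns flatness in the edge
  variables into flatness along the edge vectors.\<close>

lemma X_kernel:
  fixes p :: "(nat, 'k::field_char_0) mpoly"
  assumes "msubst Xp p \<in> idl sqs"
  shows "p \<in> idl {linform I ^ Suc (D I) | I. finite I}"
proof -
  obtain xs where xs: "distinct xs" "set xs = E"
    using finite_distinct_list[OF finite_E] by blast
  define es where "es = map (\<lambda>e. (src e, tgt e)) xs"
  have "cut_count I es = D I" for I
  proof -
    have "cut_count I es = length (filter (\<lambda>e. cuts I (src e, tgt e)) xs)"
      by (simp add: cut_count_def es_def filter_map o_def)
    also have "\<dots> = card (set (filter (\<lambda>e. cuts I (src e, tgt e)) xs))"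
      by (intro distinct_card[symmetric] distinct_filter xs(1))
    also have "set (filter (\<lambda>e. cuts I (src e, tgt e)) xs) = {e \<in> E. cuts I (src e, tgt e)}"
      by (simp only: set_filter xs(2))
    finally show ?thesis by (simp only: D_def)
  qed
  then have gens: "power_gens es = {linform I ^ Suc (D I) | I. finite I}"
    by (simp add: power_gens_def)
  have "sqs \<subseteq> ({indet e ^ 2 | e. e \<in> set xs} \<union> {indet e | e. e \<notin> set xs} :: ('e, 'k) mpoly set)"
    by (auto simp: sqs_def xs(2))
  then have "msubst Xp p \<in> idl ({indet e ^ 2 | e. e \<in> set xs} \<union> {indet e | e. e \<notin> set xs})"
    using idl_subset[OF assms] idl_gen by blast
  then have "flat (map unit_vec xs) (msubst Xp p)"
    by (rule square_ideal_imp_flat[OF xs(1)])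
  moreover have "msubst (\<lambda>_. 0) (Xp i) = (0 :: ('e, 'k) mpoly)" for i
    by (simp add: Xp_def)
  moreover have "list_all2 (\<lambda>w w'. \<forall>i. ddir w (Xp i) = (const (w' i) :: ('e, 'k) mpoly))
      (map unit_vec xs) (map edge_vec es)"
  proof -
    have "ddir (unit_vec e) (Xp i) = const (edge_vec (src e, tgt e) i :: 'k)" if "e \<in> E" for e i
    proof -
      have "ddir (unit_vec e) (Xp i) = (\<Sum>e'\<in>E. const (cf i e') * const (of_bool (e' = e)))"
        by (simp add: Xp_def unit_vec_def)
      also have "\<dots> = (\<Sum>e'\<in>E. if e' = e then const (cf i e) else 0)"
        by (rule sum.cong) auto
      finally show ?thesis using that finite_E by (simp add: cf_def)
    qed
    then show ?thesis
      by (auto simp: list_all2_conv_all_nth es_def xs(2)[symmetric])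
  qed
  ultimately have "flat (map edge_vec es) p"
    using flat_msubst_iff by blast
  then show ?thesis
    using flat_imp_power_ideal[of es p] by (simp only: gens)
qed

text \<open>The contributions of an edge with both ends in \<open>I\<close> cancel; the
  \<open>D I\<close> cut edges remain, each with a term of square zero.\<close>

lemma X_linform:
  assumes "finite I"
  shows "(\<Sum>i\<in>I. Xp i) ^ Suc (D I) \<in> idl (sqs :: ('e, 'k::field_char_0) mpoly set)"
proof -
  define a :: "'e \<Rightarrow> 'k" where "a e = of_bool (src e \<in> I) - of_bool (tgt e \<in> I)" for e
  have a: "(\<Sum>i\<in>I. const (cf i e)) = (const (a e) :: ('e, 'k) mpoly)" for e
  proof -
    have "(\<Sum>i\<in>I. const (cf i e)) = (const (\<Sum>i\<in>I. cf i e) :: ('e, 'k) mpoly)"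
      by (induction I rule: infinite_finite_induct) (simp_all add: const_add)
    also have "(\<Sum>i\<in>I. cf i e) = a e"
      using assms by (simp add: cf_def a_def edge_vec_def sum_subtractf of_bool_def)
    finally show ?thesis .
  qed
  have "(\<Sum>i\<in>I. Xp i) = (\<Sum>e\<in>E. const (a e) * (indet e :: ('e, 'k) mpoly))"
    unfolding Xp_def by (subst sum.swap) (simp add: a flip: sum_distrib_right)
  also have "\<dots> = (\<Sum>e\<in>{e \<in> E. cuts I (src e, tgt e)}. const (a e) * indet e)"
    by (rule sum.mono_neutral_right) (auto simp: finite_E a_def)
  finally show ?thesis
    using nilpotent_sum[of "{e \<in> E. cuts I (src e, tgt e)}" "\<lambda>e. const (a e) * indet e :: ('e, 'k) mpoly" 1 sqs]
    by (simp add: D_def finite_E edge_square numeral_2_eq_2[symmetric] del: power_Suc)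
qed

text \<open>One truncation order for all sums: each \<open>Xp i\<close> has nilpotency exponent at
  most \<open>card E + 1\<close>, and at most \<open>n + 1\<close> vertices are summed.\<close>

definition N :: nat where "N = card E * (n + 1) + 1"

abbreviation expN :: "('v, 'k::field_char_0) mpoly \<Rightarrow> ('v, 'k) mpoly"
  where "expN \<equiv> ueval (exp_poly N)"

abbreviation logN :: "('v, 'k::field_char_0) mpoly \<Rightarrow> ('v, 'k) mpoly"
  where "logN \<equiv> ueval (log_poly N)"

lemma card_E_less_N: "card E < N"
  by (simp add: N_def)

lemma card_E_mult_less_N: "I \<subseteq> {0..n} \<Longrightarrow> card E * card I < N"
  using card_mono[of "{0..n}" I] mult_le_mono2[of "card I" "n + 1" "card E"] by (simp add: N_def)

lemma X_nilpotent: "Xp i ^ Suc (card E) \<in> idl sqs"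
  by (rule idl_power_le[where k = "Suc (D {i})"]) (use X_linform[of "{i}"] D_le in auto)

lemma Y_cong_exp_X: "Yp i - expN (Xp i) \<in> idl (sqs :: ('e, 'k::field_char_0) mpoly set)"
proof (rule idl_cong_trans)
  let ?f = "\<lambda>e. const (cf i e) * indet e :: ('e, 'k) mpoly"
  have "- (expN (?f e) - (1 + ?f e)) \<in> idl sqs" if "e \<in> E" for e
    using edge_square[OF that] card_E_less_N by (intro idl_uminus ueval_exp_square_zero) auto
  then show "Yp i - (\<Prod>e\<in>E. expN (?f e)) \<in> idl sqs"
    unfolding Yp_def by (intro idl_cong_prod) simp
  show "(\<Prod>e\<in>E. expN (?f e)) - expN (Xp i) \<in> idl sqs"
    unfolding Xp_def
    by (rule ueval_exp_sum[where p = 1])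
       (use finite_E edge_square card_E_less_N in \<open>auto simp: numeral_2_eq_2\<close>)
qed

text \<open>Modulo the squares the product is the exponential of the sum of the \<open>Xp i\<close>,
  and this exponential minus 1 is a multiple of its argument.\<close>

lemma Y_prod:
  assumes "I \<subseteq> {0..n}"
  shows "((\<Prod>i\<in>I. Yp i) - 1) ^ Suc (D I) \<in> idl (sqs :: ('e, 'k::field_char_0) mpoly set)"
proof -
  have fin: "finite I" using assms finite_subset by blast
  let ?u = "\<Sum>i\<in>I. Xp i :: ('e, 'k) mpoly"
  have "(\<Prod>i\<in>I. Yp i) - (\<Prod>i\<in>I. expN (Xp i)) \<in> idl (sqs :: ('e, 'k) mpoly set)"
    by (rule idl_cong_prod) (rule Y_cong_exp_X)
  moreover have "(\<Prod>i\<in>I. expN (Xp i)) - expN ?u \<in> idl (sqs :: ('e, 'k) mpoly set)"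
    by (rule ueval_exp_sum[OF fin X_nilpotent card_E_mult_less_N[OF assms]])
  ultimately have "(\<Prod>i\<in>I. Yp i) - expN ?u \<in> idl sqs"
    by (rule idl_cong_trans)
  then have "((\<Prod>i\<in>I. Yp i) - 1) - (expN ?u - 1) \<in> idl sqs"
    by simp
  then have "((\<Prod>i\<in>I. Yp i) - 1) ^ Suc (D I) - (expN ?u - 1) ^ Suc (D I) \<in> idl sqs"
    by (rule idl_cong_power)
  then show ?thesis
    using ueval_exp_minus_1_power[OF X_linform[OF fin]] idl_minus_cong by blast
qed

lemma X_kernel_eq:
  fixes p :: "(nat, 'k::field_char_0) mpoly"
  assumes "vars_in {1..n} p"
  shows "msubst Xp p \<in> idl sqs \<longleftrightarrow> p \<in> idl Jgens"
proof
  assume "p \<in> idl Jgens"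
  then show "msubst Xp p \<in> idl sqs"
  proof (rule idl_msubst)
    fix g :: "(nat, 'k) mpoly" assume "g \<in> Jgens"
    then obtain I where I: "I \<subseteq> {1..n}" and g: "g = linform I ^ Suc (D I)"
      by (auto simp: Jgens_def)
    from I have "finite I" using finite_subset by blast
    from X_linform[OF this] show "msubst Xp g \<in> idl sqs"
      by (simp add: g linform_def)
  qed
next
  assume "msubst Xp p \<in> idl sqs"
  then have "p \<in> idl {linform I ^ Suc (D I) | I. finite I}"
    by (rule X_kernel)
  \<comment> \<open>Vertex 0 is eliminated as the relation that all \<open>Xp i\<close> sum to zero
    suggests; vertices beyond \<open>n\<close> lie on no edge and go to 0. The polynomial
    \<open>p\<close> contains only variables that are fixed.\<close>
  moreover define \<kappa> :: "nat \<Rightarrow> (nat, 'k) mpoly"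
    where "\<kappa> i = (if i = 0 then - linform {1..n} else if i \<le> n then indet i else 0)" for i
  ultimately have "msubst \<kappa> p \<in> idl Jgens"
  proof (elim idl_msubst)
    fix g :: "(nat, 'k) mpoly" assume "g \<in> {linform I ^ Suc (D I) | I. finite I}"
    then obtain I where fin: "finite I" and g: "g = linform I ^ Suc (D I)" by blast
    have gen: "linform I ^ Suc (D I) \<in> idl (Jgens :: (nat, 'k) mpoly set)" if "I \<subseteq> {1..n}" for I
      using that by (cases "I = {}") (auto simp: linform_def Jgens_def intro: idl.zero idl_gen)
    have \<kappa>: "(\<Sum>i\<in>I - {0}. \<kappa> i) = linform (I \<inter> {1..n})"
      unfolding linform_def using fin
      by (intro sum.mono_neutral_cong_right) (auto simp: \<kappa>_def)
    show "msubst \<kappa> g \<in> idl Jgens"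
    proof (cases "0 \<in> I")
      case False
      then have "msubst \<kappa> (linform I) = linform (I \<inter> {1..n})"
        using \<kappa> by (simp add: linform_def)
      moreover have "D I = D (I \<inter> {1..n})"
      proof -
        have "I \<inter> {0..n} = I \<inter> {1..n}" using False by (auto simp: Suc_le_eq intro: gr0I)
        then show ?thesis using D_Int[of I] by simp
      qed
      ultimately show ?thesis using gen[of "I \<inter> {1..n}"] by (simp add: g)
    next
      \<comment> \<open>With 0 in \<open>I\<close>, the form becomes minus the form of the
        complement, which has the same cut.\<close>
      case True
      have "(linform {1..n} :: (nat, 'k) mpoly) = linform (I \<inter> {1..n}) + linform ({1..n} - I)"
        unfolding linform_def by (subst sum.union_disjoint[symmetric]) (auto intro: sum.cong)
      then have "msubst \<kappa> (linform I) = - linform ({1..n} - I)"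
        using \<kappa> True fin by (simp add: linform_def sum.remove[of I 0] \<kappa>_def[of 0])
      moreover have "D I = D ({1..n} - I)"
      proof -
        have "{0..n} - I = {1..n} - I" using True by (auto simp: Suc_le_eq intro: gr0I)
        then show ?thesis using D_Compl[of I] by simp
      qed
      moreover have "(- linform ({1..n} - I)) ^ Suc (D ({1..n} - I)) \<in> idl (Jgens :: (nat, 'k) mpoly set)"
        unfolding power_minus[of "linform ({1..n} - I)"] by (intro idl_mult_left gen) auto
      ultimately show ?thesis by (simp add: g)
    qed
  qed
  moreover have "msubst \<kappa> p = p"
    using assms by (rule msubst_fixes) (auto simp: \<kappa>_def)
  ultimately show "p \<in> idl Jgens" by simp
qed

lemma Y_kernel_eq:
  fixes p :: "(nat, 'k::field_char_0) mpoly"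
  assumes p: "vars_in {0..n} p"
  shows "msubst Yp p \<in> idl sqs \<longleftrightarrow> p \<in> idl Igens"
proof
  assume "p \<in> idl Igens"
  then show "msubst Yp p \<in> idl sqs"
  proof (rule idl_msubst)
    fix g :: "(nat, 'k) mpoly" assume "g \<in> Igens"
    then obtain I where "I \<subseteq> {0..n}" and g: "g = ((\<Prod>i\<in>I. indet i) - 1) ^ Suc (D I)"
      by (auto simp: Igens_def)
    from Y_prod[OF this(1)] show "msubst Yp g \<in> idl sqs"
      by (simp add: g)
  qed
next
  assume Y: "msubst Yp p \<in> idl sqs"
  define F where "F = msubst (\<lambda>i. expN (indet i)) p"
  have "msubst Yp p - msubst (\<lambda>i. expN (Xp i)) p \<in> idl sqs"
    using p by (rule idl_cong_msubst) (rule Y_cong_exp_X)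
  then have "msubst (\<lambda>i. expN (Xp i)) p \<in> idl sqs"
    using Y idl_minus_cong by blast
  then have "msubst Xp F \<in> idl sqs"
    by (simp add: F_def msubst_msubst)
  then have F: "F \<in> idl {linform I ^ Suc (D I) | I. finite I}"
    by (rule X_kernel)
  \<comment> \<open>Vertex 0 keeps its own variable here, since \<open>Igens\<close> includes sets
    containing 0. Vertices beyond \<open>n\<close> go to 0, the logarithm of 1.\<close>
  define l :: "nat \<Rightarrow> (nat, 'k) mpoly" where "l i = (if i \<le> n then logN (indet i - 1) else 0)" for i
  have y_nil: "(indet i - 1) ^ Suc (card E) \<in> idl Igens" if "i \<le> n" for i
  proof (rule idl_power_le)
    show "(indet i - 1) ^ Suc (D {i}) \<in> idl Igens"
      using that by (intro idl_gen) (auto simp: Igens_def intro!: exI[of _ "{i}"])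
  qed (simp add: D_le)
  have exp_l: "expN (l i) - indet i \<in> idl Igens" if "i \<le> n" for i
    using ueval_exp_log[OF y_nil[OF that], of N] card_E_less_N that by (simp add: l_def)
  have l_nil: "l i ^ Suc (card E) \<in> idl Igens" if "i \<le> n" for i
    using ueval_log_power[OF y_nil[OF that], of N] that by (simp add: l_def)
  from F have "msubst l F \<in> idl Igens"
  proof (rule idl_msubst)
    fix g :: "(nat, 'k) mpoly" assume "g \<in> {linform I ^ Suc (D I) | I. finite I}"
    then obtain I where fin: "finite I" and g: "g = linform I ^ Suc (D I)" by blast
    define I' where "I' = I \<inter> {0..n}"
    let ?s = "\<Sum>i\<in>I'. l i" and ?P = "\<Prod>i\<in>I'. indet i :: (nat, 'k) mpoly"
    have fin': "finite I'" and sub: "I' \<subseteq> {0..n}" by (auto simp: I'_def)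
    have "msubst l (linform I) = (\<Sum>i\<in>I. l i)"
      by (simp add: linform_def)
    also have "\<dots> = ?s"
      using fin by (intro sum.mono_neutral_right) (auto simp: I'_def l_def)
    finally have lin: "msubst l (linform I) = ?s" .
    \<comment> \<open>The exponential of the sum \<open>?s\<close> of logarithms is congruent to
      \<open>?P\<close>; taking logarithms again makes \<open>?s\<close> congruent to
      \<open>logN (?P - 1)\<close>, a multiple of \<open>?P - 1\<close>.\<close>
    have "?s ^ Suc (D I') \<in> idl Igens"
    proof (cases "I' = {}")
      case False
      have "expN ?s - ?P \<in> idl Igens"
      proof (rule idl_cong_trans)
        show "(\<Prod>i\<in>I'. expN (l i)) - ?P \<in> idl Igens"
          using sub by (intro idl_cong_prod exp_l) auto
        have "(\<Prod>i\<in>I'. expN (l i)) - expN ?s \<in> idl Igens"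
          using sub by (intro ueval_exp_sum[OF fin' l_nil card_E_mult_less_N]) auto
        from idl_uminus[OF this] show "expN ?s - (\<Prod>i\<in>I'. expN (l i)) \<in> idl Igens" by simp
      qed
      then have "(expN ?s - 1) - (?P - 1) \<in> idl Igens" by simp
      then have "logN (expN ?s - 1) - logN (?P - 1) \<in> idl Igens"
        by (rule idl_cong_ueval)
      moreover have "?s ^ Suc (card E * card I') \<in> idl Igens"
        using sub by (intro nilpotent_sum[OF fin'] l_nil) auto
      then have "logN (expN ?s - 1) - ?s \<in> idl Igens"
        using card_E_mult_less_N[OF sub] by (intro ueval_log_exp[where k = "Suc (card E * card I')"]) auto
      then have "?s - logN (expN ?s - 1) \<in> idl Igens"
        using idl_uminus by fastforce
      ultimately have "?s - logN (?P - 1) \<in> idl Igens"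
        using idl_cong_trans by blast
      then have "?s ^ Suc (D I') - logN (?P - 1) ^ Suc (D I') \<in> idl Igens"
        by (rule idl_cong_power)
      moreover have "(?P - 1) ^ Suc (D I') \<in> idl Igens"
        using False sub by (intro idl_gen) (auto simp: Igens_def)
      then have "logN (?P - 1) ^ Suc (D I') \<in> idl Igens"
        by (rule ueval_log_power)
      ultimately show ?thesis using idl_minus_cong by blast
    qed (simp add: idl.zero)
    then show "msubst l g \<in> idl Igens"
      using D_Int[of I] by (simp add: g lin I'_def)
  qed
  \<comment> \<open>\<open>F\<close> arose from \<open>p\<close> by substituting exponentials, which
    \<open>l\<close> undoes modulo the ideal.\<close>
  moreover have "msubst l F - p \<in> idl Igens"
    using idl_cong_msubst[OF p, of "\<lambda>i. expN (l i)" indet Igens] exp_l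
    by (simp add: F_def msubst_msubst msubst_id)
  ultimately show "p \<in> idl Igens"
    using idl_minus_cong by blast
qed

section \<open>Expressing the two families of generators in each other\<close>

lemma exists_X_of_Y:
  fixes p :: "(nat, 'k::field_char_0) mpoly"
  assumes p: "vars_in {0..n} p"
  shows "\<exists>q. vars_in {1..n} q \<and> msubst Yp p - msubst Xp q \<in> idl sqs"
proof (intro exI conjI)
  define \<kappa> :: "nat \<Rightarrow> (nat, 'k) mpoly"
    where "\<kappa> i = (if i = 0 then - linform {1..n} else indet i)" for i
  define q where "q = msubst (\<lambda>i. expN (\<kappa> i)) p"
  show "vars_in {1..n} q"
    unfolding q_def using p
    by (rule vars_in_msubst) (auto intro!: vars_in_ueval vars_in_intros simp: \<kappa>_def linform_def)
  have X: "Xp i - msubst Xp (\<kappa> i) \<in> idl (sqs :: ('e, 'k) mpoly set)" for i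
  proof (cases "i = 0")
    case True
    have "{0..n} = insert 0 {1..n}" by auto
    then have "Xp 0 - msubst Xp (\<kappa> 0) = (\<Sum>i\<in>{0..n}. Xp i :: ('e, 'k) mpoly)"
      by (simp add: \<kappa>_def linform_def)
    \<comment> \<open>No edge leaves the full vertex set, so \<open>X_linform\<close> with exponent
      1 says that the \<open>Xp i\<close> sum to zero modulo the squares.\<close>
    moreover have "D {0..n} = 0"
      using D_Compl[of "{}"] by (simp add: D_def)
    ultimately show ?thesis
      using X_linform[of "{0..n}"] True by simp
  qed (simp add: \<kappa>_def idl.zero)
  have "Yp i - expN (msubst Xp (\<kappa> i)) \<in> idl (sqs :: ('e, 'k) mpoly set)" for i
    using Y_cong_exp_X idl_cong_ueval[OF X] by (rule idl_cong_trans)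
  then show "msubst Yp p - msubst Xp q \<in> idl sqs"
    using idl_cong_msubst[OF p, of Yp "\<lambda>i. expN (msubst Xp (\<kappa> i))" sqs]
    by (simp add: q_def msubst_msubst)
qed

lemma exists_Y_of_X:
  fixes p :: "(nat, 'k::field_char_0) mpoly"
  assumes p: "vars_in {1..n} p"
  shows "\<exists>q. vars_in {0..n} q \<and> msubst Xp p - msubst Yp q \<in> idl sqs"
proof (intro exI conjI)
  define q where "q = msubst (\<lambda>i. logN (indet i - 1)) p"
  show "vars_in {0..n} q"
    unfolding q_def using p
    by (rule vars_in_msubst) (auto intro!: vars_in_ueval vars_in_diff)
  have "Xp i - logN (Yp i - 1) \<in> idl (sqs :: ('e, 'k) mpoly set)" for i
  proof (rule idl_cong_trans)
    have "logN (expN (Xp i) - 1) - Xp i \<in> idl (sqs :: ('e, 'k) mpoly set)"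
      using card_E_less_N by (intro ueval_log_exp[OF X_nilpotent]) simp
    from idl_uminus[OF this] show "Xp i - logN (expN (Xp i) - 1) \<in> idl (sqs :: ('e, 'k) mpoly set)"
      by simp
    have "- (Yp i - expN (Xp i)) \<in> idl (sqs :: ('e, 'k) mpoly set)"
      by (rule idl_uminus[OF Y_cong_exp_X])
    then have "(expN (Xp i) - 1) - (Yp i - 1) \<in> idl (sqs :: ('e, 'k) mpoly set)"
      by simp
    then show "logN (expN (Xp i) - 1) - logN (Yp i - 1) \<in> idl (sqs :: ('e, 'k) mpoly set)"
      by (rule idl_cong_ueval)
  qed
  then show "msubst Xp p - msubst Yp q \<in> idl sqs"
    using idl_cong_msubst[OF p, of Xp "\<lambda>i. logN (Yp i - 1)" sqs]
    by (simp add: q_def msubst_msubst)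
qed

lemma vars_in_Xp: "vars_in E (Xp i)" and vars_in_Yp: "vars_in E (Yp i)"
  unfolding Xp_def Yp_def by (auto intro!: vars_in_intros)

end


section \<open>Quotients of polynomial algebras\<close>

lemma poly_algebra_simps [simp]:
  "carrier (poly_algebra K V) = Collect (vars_in V)"
  "p \<otimes>\<^bsub>poly_algebra K V\<^esub> q = p * q"
  "p \<oplus>\<^bsub>poly_algebra K V\<^esub> q = p + q"
  "\<one>\<^bsub>poly_algebra K V\<^esub> = 1"
  "\<zero>\<^bsub>poly_algebra K V\<^esub> = 0"
  "a \<odot>\<^bsub>poly_algebra K V\<^esub> p = const a * p"
  by (simp_all add: poly_algebra_def vars_in_def[abs_def] const_def)

lemma cring_poly_algebra: "cring (poly_algebra K V)"
proof (rule cringI)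
  show "abelian_group (poly_algebra K V)"
  proof (rule abelian_groupI)
    fix p assume "p \<in> carrier (poly_algebra K V)"
    then show "\<exists>q\<in>carrier (poly_algebra K V). q \<oplus>\<^bsub>poly_algebra K V\<^esub> p = \<zero>\<^bsub>poly_algebra K V\<^esub>"
      by (intro bexI[of _ "- p"]) (auto intro: vars_in_uminus)
  qed (auto intro: vars_in_add simp: ac_simps)
  show "comm_monoid (poly_algebra K V)"
    by (rule comm_monoidI) (auto intro: vars_in_mult simp: ac_simps)
qed (auto simp: distrib_right)

locale poly_quotient =
  fixes K :: "'k::field itself" and V :: "'v set" and G :: "('v, 'k) mpoly set"
  assumes gens_vars: "g \<in> G \<Longrightarrow> vars_in V g"
begin

abbreviation A :: "('k, ('v, 'k) mpoly) module"
  where "A \<equiv> poly_algebra K V"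

definition I :: "('v, 'k) mpoly set"
  where "I = {p. vars_in V p \<and> p \<in> idl G}"

definition Q :: "('k, ('v, 'k) mpoly set) module"
  where "Q = quotient_algebra A I"

definition proj :: "('v, 'k) mpoly \<Rightarrow> ('v, 'k) mpoly set"
  where "proj p = I +>\<^bsub>A\<^esub> p"

sublocale A: cring A
  by (rule cring_poly_algebra)

lemma ideal_I: "ideal I A"
proof (rule idealI)
  have inv: "\<ominus>\<^bsub>A\<^esub> p = - p" if "vars_in V p" for p
    using that by (intro A.minus_equality) (auto intro: vars_in_uminus)
  show "subgroup I (add_monoid A)"
    by (rule A.add.subgroupI)
       (auto simp: I_def inv intro!: vars_in_add vars_in_uminus idl.zero exI[of _ 0])
qed (auto simp: I_def A.ring_axioms intro: vars_in_mult)

sublocale I: ideal I A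
  by (rule ideal_I)

text \<open>Coefficients in \<open>idl\<close> may involve variables outside \<open>V\<close>. The
  retraction \<open>\<rho>\<close> sends those to 0 and fixes the generators, so it moves such a
  combination into the carrier.\<close>

lemma genideal_eq: "Idl\<^bsub>A\<^esub> G = I"
proof
  show "Idl\<^bsub>A\<^esub> G \<subseteq> I"
    by (rule A.genideal_minimal[OF ideal_I]) (auto simp: I_def gens_vars idl_gen)
next
  have sub: "G \<subseteq> carrier A" by (auto simp: gens_vars)
  interpret J: ideal "Idl\<^bsub>A\<^esub> G" A
    by (rule A.genideal_ideal[OF sub])
  define \<rho> :: "'v \<Rightarrow> ('v, 'k) mpoly" where "\<rho> v = (if v \<in> V then indet v else 0)" for v
  have fix_vars: "msubst \<rho> p = p" if "vars_in V p" for p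
    using that by (rule msubst_fixes) (simp add: \<rho>_def)
  have vars: "vars_in V (msubst \<rho> p)" for p
    by (rule vars_in_msubst[of UNIV]) (auto simp: vars_in_def[of UNIV] \<rho>_def)
  have "msubst \<rho> p \<in> Idl\<^bsub>A\<^esub> G" if "p \<in> idl G" for p
    using that
  proof (induction rule: idl.induct)
    case zero
    then show ?case using J.zero_closed by simp
  next
    case (step g a r)
    have "g \<in> Idl\<^bsub>A\<^esub> G" using A.genideal_self[OF sub] step(1) by blast
    then have "msubst \<rho> r * g \<in> Idl\<^bsub>A\<^esub> G"
      using J.I_l_closed[of g "msubst \<rho> r"] vars by simp
    then show ?case
      using J.a_closed[of "msubst \<rho> r * g" "msubst \<rho> a"] step by (simp add: fix_vars gens_vars)
  qed
  then show "I \<subseteq> Idl\<^bsub>A\<^esub> G"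
    using fix_vars by (fastforce simp: I_def)
qed

lemma proj_eq_iff:
  assumes "vars_in V p" "vars_in V q"
  shows "proj p = proj q \<longleftrightarrow> p - q \<in> idl G"
proof
  assume "proj p = proj q"
  moreover have "p \<in> proj p"
    by (auto simp: proj_def a_r_coset_def' I_def intro!: exI[of _ 0] idl.zero)
  ultimately have "p \<in> proj q" by simp
  then show "p - q \<in> idl G"
    by (auto simp: proj_def a_r_coset_def' I_def)
next
  have "proj p \<subseteq> proj q" if "vars_in V p" "vars_in V q" "p - q \<in> idl G" for p q
  proof
    fix x assume "x \<in> proj p"
    then obtain i where i: "i \<in> I" "x = i + p"
      by (auto simp: proj_def a_r_coset_def')
    then have "i + (p - q) \<in> I"
      using that by (auto simp: I_def intro: vars_in_intros)
    then show "x \<in> proj q"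
      using i by (auto simp: proj_def a_r_coset_def' intro!: bexI[of _ "i + (p - q)"])
  qed
  moreover assume "p - q \<in> idl G"
  moreover from this have "q - p \<in> idl G" using idl_uminus by fastforce
  ultimately show "proj p = proj q" using assms by blast
qed

lemma Q_ops:
  "carrier Q = proj ` Collect (vars_in V)"
  "vars_in V p \<Longrightarrow> vars_in V q \<Longrightarrow> proj p \<otimes>\<^bsub>Q\<^esub> proj q = proj (p * q)"
  "vars_in V p \<Longrightarrow> vars_in V q \<Longrightarrow> proj p \<oplus>\<^bsub>Q\<^esub> proj q = proj (p + q)"
  "\<one>\<^bsub>Q\<^esub> = proj 1" "\<zero>\<^bsub>Q\<^esub> = proj 0"
proof -
  have hom: "proj \<in> ring_hom A (A Quot I)"
    using I.rcos_ring_hom by (simp add: proj_def[abs_def])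
  show "carrier Q = proj ` Collect (vars_in V)"
    by (auto simp: Q_def quotient_algebra_def FactRing_def A_RCOSETS_def' proj_def)
  show "vars_in V p \<Longrightarrow> vars_in V q \<Longrightarrow> proj p \<otimes>\<^bsub>Q\<^esub> proj q = proj (p * q)"
    using ring_hom_mult[OF hom, of p q] by (simp add: Q_def quotient_algebra_def)
  show "vars_in V p \<Longrightarrow> vars_in V q \<Longrightarrow> proj p \<oplus>\<^bsub>Q\<^esub> proj q = proj (p + q)"
    using ring_hom_add[OF hom, of p q] by (simp add: Q_def quotient_algebra_def)
  show "\<one>\<^bsub>Q\<^esub> = proj 1"
    using ring_hom_one[OF hom] by (simp add: Q_def quotient_algebra_def)
  show "\<zero>\<^bsub>Q\<^esub> = proj 0"
    by (simp add: Q_def quotient_algebra_def FactRing_def proj_def a_r_coset_def')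
qed

lemma Q_smult:
  assumes "vars_in V p"
  shows "a \<odot>\<^bsub>Q\<^esub> proj p = proj (const a * p)"
proof -
  have "proj (const a * q) = proj (const a * p)" if "q \<in> proj p" for q
  proof -
    from that obtain i where i: "i \<in> I" "q = i + p"
      by (auto simp: proj_def a_r_coset_def')
    then have "const a * q - const a * p \<in> idl G"
      by (auto simp: I_def algebra_simps)
    then show ?thesis
      using i assms by (subst proj_eq_iff) (auto simp: I_def intro!: vars_in_intros)
  qed
  moreover have "p \<in> proj p"
    by (auto simp: proj_def a_r_coset_def' I_def intro!: exI[of _ 0] idl.zero)
  ultimately have "(\<Union>q\<in>proj p. proj (const a * q)) = proj (const a * p)" by blast
  then show ?thesis
    by (simp add: Q_def quotient_algebra_def proj_def)
qed

lemma cring_Q: "cring Q"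
proof -
  interpret AI: cring "A Quot I"
    by (rule I.quotient_is_cring[OF A.cring_axioms])
  have "id \<in> ring_iso (A Quot I) Q"
    by (rule ring_iso_memI) (auto simp: Q_def quotient_algebra_def)
  from AI.ring_iso_imp_img_cring[OF this] have "cring (Q\<lparr>zero := zero (A Quot I)\<rparr>)" by simp
  moreover have "Q\<lparr>zero := zero (A Quot I)\<rparr> = Q" by (simp add: Q_def quotient_algebra_def)
  ultimately show ?thesis by simp
qed

sublocale Q: cring Q
  by (rule cring_Q)

lemma finsum_proj:
  assumes "\<And>i. i \<in> S \<Longrightarrow> vars_in V (f i)" "finite S"
  shows "(\<Oplus>\<^bsub>Q\<^esub>i\<in>S. proj (f i)) = proj (\<Sum>i\<in>S. f i)"
  using assms(2,1)
proof (induction S)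
  case empty
  then show ?case by (simp add: Q_ops)
next
  case (insert x S)
  then have "(\<lambda>i. proj (f i)) \<in> S \<rightarrow> carrier Q" "proj (f x) \<in> carrier Q"
    by (auto simp: Q_ops)
  then show ?case
    using insert by (simp add: Q_ops vars_in_sum)
qed

lemma finprod_proj:
  assumes "\<And>i. i \<in> S \<Longrightarrow> vars_in V (f i)" "finite S"
  shows "(\<Otimes>\<^bsub>Q\<^esub>i\<in>S. proj (f i)) = proj (\<Prod>i\<in>S. f i)"
  using assms(2,1)
proof (induction S)
  case empty
  then show ?case by (simp add: Q_ops)
next
  case (insert x S)
  then have "(\<lambda>i. proj (f i)) \<in> S \<rightarrow> carrier Q" "proj (f x) \<in> carrier Q"
    by (auto simp: Q_ops)
  then show ?case
    using insert by (simp add: Q_ops vars_in_prod)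
qed

end


section \<open>Evaluation maps and their images\<close>

locale poly_evaluation =
  target: poly_quotient K V G
  for K :: "'k::field itself" and V :: "'v set" and G :: "('v, 'k) mpoly set" +
  fixes W :: "'w set" and s :: "'w \<Rightarrow> ('v, 'k) mpoly"
  assumes s_vars: "vars_in V (s w)"
begin

definition ev :: "('w, 'k) mpoly \<Rightarrow> ('v, 'k) mpoly set"
  where "ev p = target.proj (msubst s p)"

definition image_algebra :: "('k, ('v, 'k) mpoly set) module"
  where "image_algebra = target.Q\<lparr>carrier := ev ` carrier (poly_algebra K W)\<rparr>"

lemma msubst_vars: "vars_in V (msubst s p)"
  by (rule vars_in_msubst[of UNIV]) (auto simp: vars_in_def[of UNIV] s_vars)

lemma ev_hom: "ring_hom_ring (poly_algebra K W) target.Q ev"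
proof (rule ring_hom_ringI2)
  show "ring (poly_algebra K W)" "ring target.Q"
    by (simp_all add: cring.axioms(1) cring_poly_algebra target.cring_Q)
  show "ev \<in> ring_hom (poly_algebra K W) target.Q"
    by (rule ring_hom_memI) (auto simp: ev_def target.Q_ops msubst_vars)
qed

lemma ev_smult: "ev (const a * p) = a \<odot>\<^bsub>target.Q\<^esub> ev p"
  by (simp add: ev_def target.Q_smult msubst_vars)

text \<open>\<open>X\<close> may exceed the values of the variables, since \<open>K_alg\<close> also
  lists 1 among its generators.\<close>

lemma generated_subalgebra_eq:
  assumes "X \<subseteq> carrier image_algebra" "\<And>w. w \<in> W \<Longrightarrow> ev (indet w) \<in> X"
  shows "generated_subalgebra target.Q X = image_algebra"
proof -
  interpret h: ring_hom_ring "poly_algebra K W" target.Q ev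
    by (rule ev_hom)
  let ?S = "ev ` carrier (poly_algebra K W)"
  have "is_subalgebra ?S target.Q"
    unfolding is_subalgebra_def
  proof (intro conjI allI ballI)
    show "subring ?S target.Q"
      by (rule h.img_is_subring) (rule h.R.carrier_is_subring)
    fix a x assume "x \<in> ?S"
    then show "a \<odot>\<^bsub>target.Q\<^esub> x \<in> ?S"
      by (auto simp: ev_smult[symmetric] intro!: imageI vars_in_mult)
  qed
  moreover have "X \<subseteq> ?S"
    using assms(1) by (simp add: image_algebra_def)
  moreover have "?S \<subseteq> S" if S: "is_subalgebra S target.Q" "X \<subseteq> S" for S
  proof
    have sub: "subring S target.Q" and smult: "\<And>a x. x \<in> S \<Longrightarrow> a \<odot>\<^bsub>target.Q\<^esub> x \<in> S"
      using S(1) by (auto simp: is_subalgebra_def)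
    have "ev p \<in> S" if "vars_in W p" for p
      using that
    proof (induction rule: mpoly_induct)
      case (const a)
      have "ev 1 \<in> S"
        using subringE(3)[OF sub] by (simp add: ev_def target.Q_ops)
      from smult[OF this, of a] show ?case
        by (simp add: ev_smult[symmetric])
    next
      case (indet v)
      then show ?case using assms(2) S(2) by blast
    next
      case (add p q)
      then show ?case
        using subringE(7)[OF sub, of "ev p" "ev q"] by (simp add: ev_def target.Q_ops msubst_vars)
    next
      case (mult p q)
      then show ?case
        using subringE(6)[OF sub, of "ev p" "ev q"] by (simp add: ev_def target.Q_ops msubst_vars)
    qed
    then show "x \<in> S" if "x \<in> ?S" for x using that by auto
  qed
  ultimately have "\<Inter>{S. is_subalgebra S target.Q \<and> X \<subseteq> S} = ?S" by blast
  then show ?thesis by (simp add: generated_subalgebra_def image_algebra_def)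
qed

text \<open>The first isomorphism theorem, with \<open>ker\<close> identifying the kernel;
  compatibility with scalars is checked on representatives.\<close>

lemma quotient_iso_image:
  assumes H: "\<And>g. g \<in> H \<Longrightarrow> vars_in W g"
    and ker: "\<And>p. vars_in W p \<Longrightarrow> msubst s p \<in> idl G \<longleftrightarrow> p \<in> idl H"
  shows "quotient_algebra (poly_algebra K W) (Idl\<^bsub>poly_algebra K W\<^esub> H) \<cong>\<^sub>a\<^sub>l\<^sub>g image_algebra"
proof -
  interpret source: poly_quotient K W H
    by unfold_locales (rule H)
  interpret h: ring_hom_ring "poly_algebra K W" target.Q ev
    by (rule ev_hom)
  have kernel: "a_kernel (poly_algebra K W) target.Q ev = source.I"
    using target.proj_eq_iff[OF msubst_vars, of 0]
    by (auto simp: a_kernel_def' source.I_def ev_def target.Q_ops ker)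
  let ?h = "\<lambda>X. the_elem (ev ` X)"
  have iso: "?h \<in> ring_iso (source.A Quot source.I) image_algebra"
    using h.FactRing_iso_set_aux by (simp add: kernel image_algebra_def)
  have "?h \<in> ring_iso source.Q image_algebra"
    using iso by (simp add: ring_iso_def ring_hom_def source.Q_def quotient_algebra_def)
  moreover have "?h (a \<odot>\<^bsub>source.Q\<^esub> X) = a \<odot>\<^bsub>image_algebra\<^esub> ?h X" if "X \<in> carrier source.Q" for a X
  proof -
    have ev: "?h (source.proj p) = ev p" if "vars_in W p" for p
      using h.the_elem_simp[of p] that by (simp add: kernel source.proj_def)
    from that obtain p where p: "vars_in W p" "X = source.proj p"
      by (auto simp: source.Q_ops)
    then show ?thesis
      by (simp add: source.Q_smult ev vars_in_mult ev_smult image_algebra_def)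
  qed
  ultimately have "?h \<in> algebra_iso source.Q image_algebra"
    by (simp add: algebra_iso_def)
  then show ?thesis
    unfolding algebra_isomorphic_def source.genideal_eq source.Q_def by blast
qed

end

section \<open>Isomorphism of algebras as an equivalence\<close>

lemma algebra_isomorphic_refl: "A \<cong>\<^sub>a\<^sub>l\<^sub>g A"
proof -
  have "id \<in> algebra_iso A A"
    unfolding algebra_iso_def using ring_iso_set_refl by simp
  then show ?thesis by (auto simp: algebra_isomorphic_def)
qed

lemma algebra_isomorphic_trans:
  assumes "A \<cong>\<^sub>a\<^sub>l\<^sub>g B" "B \<cong>\<^sub>a\<^sub>l\<^sub>g C"
  shows "A \<cong>\<^sub>a\<^sub>l\<^sub>g C"
proof -
  obtain f g where "f \<in> algebra_iso A B" "g \<in> algebra_iso B C"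
    using assms by (auto simp: algebra_isomorphic_def)
  then have "g \<circ> f \<in> algebra_iso A C"
    using ring_iso_set_trans[of f A B g C] ring_iso_memE(1)[of f A B]
    by (auto simp: algebra_iso_def)
  then show ?thesis by (auto simp: algebra_isomorphic_def)
qed

text \<open>The record type carries no axioms, so the ring laws and closure under scalars are
  assumed for the algebra in which the inverse takes its values.\<close>

lemma algebra_isomorphic_sym:
  assumes "ring A" "\<And>a x. x \<in> carrier A \<Longrightarrow> a \<odot>\<^bsub>A\<^esub> x \<in> carrier A" "A \<cong>\<^sub>a\<^sub>l\<^sub>g B"
  shows "B \<cong>\<^sub>a\<^sub>l\<^sub>g A"
proof -
  obtain f where f: "f \<in> ring_iso A B"
      "\<And>a x. x \<in> carrier A \<Longrightarrow> f (a \<odot>\<^bsub>A\<^esub> x) = a \<odot>\<^bsub>B\<^esub> f x"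
    using assms by (auto simp: algebra_isomorphic_def algebra_iso_def)
  let ?g = "inv_into (carrier A) f"
  have bij: "bij_betw f (carrier A) (carrier B)"
    using f(1) by (simp add: ring_iso_def)
  have "?g (a \<odot>\<^bsub>B\<^esub> y) = a \<odot>\<^bsub>A\<^esub> ?g y" if "y \<in> carrier B" for a y
  proof -
    obtain x where "x \<in> carrier A" "y = f x"
      using bij \<open>y \<in> carrier B\<close> by (metis bij_betw_imp_surj_on imageE)
    then show ?thesis
      using bij assms(2) by (simp add: f(2)[symmetric] bij_betw_inv_into_left)
  qed
  then have "?g \<in> algebra_iso B A"
    using ring_iso_set_sym[OF assms(1) f(1)] by (simp add: algebra_iso_def)
  then show ?thesis by (auto simp: algebra_isomorphic_def)
qed


section \<open>The four algebras\<close>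

theorem theorem2:
  fixes K :: "'k::field_char_0 itself"
    and n :: nat
    and E :: "'e set"
    and ends :: "'e \<Rightarrow> nat set"
  assumes "multigraph n E ends"
  shows "B_alg K n E ends \<cong>\<^sub>a\<^sub>l\<^sub>g C_alg K n E ends
       \<and> B_alg K n E ends \<cong>\<^sub>a\<^sub>l\<^sub>g D_alg K n E ends
       \<and> B_alg K n E ends \<cong>\<^sub>a\<^sub>l\<^sub>g K_alg K n E ends
       \<and> C_alg K n E ends \<cong>\<^sub>a\<^sub>l\<^sub>g D_alg K n E ends
       \<and> C_alg K n E ends \<cong>\<^sub>a\<^sub>l\<^sub>g K_alg K n E ends
       \<and> D_alg K n E ends \<cong>\<^sub>a\<^sub>l\<^sub>g K_alg K n E ends"
proof -
  \<comment> \<open>Orienting each edge from its smaller to its larger endpoint makes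
    \<open>edge_vec\<close> reproduce the signs of \<open>edge_sign\<close>.\<close>
  define src tgt where "src e = Min (ends e)" and "tgt e = Max (ends e)" for e
  have ends: "ends e = {src e, tgt e} \<and> src e < tgt e \<and> tgt e \<le> n" if "e \<in> E" for e
  proof -
    obtain i j where "i \<le> n" "j \<le> n" "i \<noteq> j" "ends e = {i, j}"
      using assms \<open>e \<in> E\<close> unfolding multigraph_def by blast
    then show ?thesis by (cases "i < j") (auto simp: src_def tgt_def)
  qed
  interpret oriented_graph n E src tgt
    using assms ends by unfold_locales (fastforce simp: multigraph_def)+
  have cf: "edge_sign K ends i e = cf i e" if "e \<in> E" for i e
    using ends[OF that] unfolding edge_sign_def cf_def edge_vec_def
    by (auto simp: doubleton_eq_iff)
  have cut: "cut_size E ends I = D I" for I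
  proof -
    have "card (ends e \<inter> I) = 1 \<longleftrightarrow> cuts I (src e, tgt e)" if "e \<in> E" for e
      using ends[OF that] by (auto simp: Int_insert_left)
    then have "{e \<in> E. card (ends e \<inter> I) = 1} = {e \<in> E. cuts I (src e, tgt e)}" by blast
    then show ?thesis by (simp only: cut_size_def D_def)
  qed

  interpret Phi: poly_quotient K E sqs
    by unfold_locales (auto simp: sqs_def intro: vars_in_power)
  interpret X: poly_evaluation K E sqs "{1..n}" Xp
    by unfold_locales (rule vars_in_Xp)
  interpret Y: poly_evaluation K E sqs "{0..n}" Yp
    by unfold_locales (rule vars_in_Yp)

  have Phi_ideal: "Phi_ideal K E = Phi.I"
    unfolding Phi_ideal_def Phi.genideal_eq[symmetric] by (simp add: sqs_def)
  have Phi_alg: "Phi_alg K E = Phi.Q"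
    by (simp add: Phi_alg_def Phi_ideal Phi.Q_def)
  have phi: "phi K E e = Phi.proj (indet e)" for e
    by (simp add: phi_def Phi_ideal Phi.proj_def)
  have X_elem: "X_elem K E ends i = Phi.proj (Xp i)" for i
  proof -
    have "X_elem K E ends i = (\<Oplus>\<^bsub>Phi.Q\<^esub>e\<in>E. Phi.proj (const (cf i e) * indet e))"
      unfolding X_elem_def Phi_alg phi
      by (rule Phi.Q.add.finprod_cong') (auto simp: cf Phi.Q_smult Phi.Q_ops intro!: vars_in_mult)
    then show ?thesis
      by (simp add: Phi.finsum_proj finite_E vars_in_mult Xp_def)
  qed
  have Y_elem: "Y_elem K E ends i = Phi.proj (Yp i)" for i
  proof -
    have "Y_elem K E ends i = (\<Otimes>\<^bsub>Phi.Q\<^esub>e\<in>E. Phi.proj (1 + const (cf i e) * indet e))"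
      unfolding Y_elem_def Phi_alg phi
      by (rule Phi.Q.finprod_cong')
         (auto simp: cf Phi.Q_smult Phi.Q_ops vars_in_mult intro!: vars_in_intros)
    then show ?thesis
      by (simp add: Phi.finprod_proj finite_E vars_in_intros Yp_def)
  qed

  have X_ev: "X_elem K E ends i = X.ev (indet i)" and Y_ev: "Y_elem K E ends i = Y.ev (indet i)" for i
    by (simp_all add: X.ev_def X_elem Y.ev_def Y_elem)
  have "X.ev (indet i) \<in> carrier X.image_algebra" if "i \<in> {1..n}" for i
    unfolding X.image_algebra_def using that by (simp add: imageI)
  then have C: "C_alg K n E ends = X.image_algebra"
    unfolding C_alg_def Phi_alg X_ev by (intro X.generated_subalgebra_eq) blast+
  have "Y.ev (indet i) \<in> carrier Y.image_algebra" if "i \<in> {0..n}" for i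
    unfolding Y.image_algebra_def using that by (simp add: imageI)
  moreover have "\<one>\<^bsub>Phi.Q\<^esub> \<in> carrier Y.image_algebra"
    unfolding Y.image_algebra_def Y.ev_def Phi.Q_ops by (simp add: image_eqI[of _ _ 1])
  ultimately have "K_alg K n E ends = Y.image_algebra"
    unfolding K_alg_def Phi_alg Y_ev by (intro Y.generated_subalgebra_eq) blast+
  \<comment> \<open>The two subalgebras are equal, not merely isomorphic, so it remains to map
    \<open>B_alg\<close> and \<open>D_alg\<close> isomorphically onto this one.\<close>
  also have XY: "Y.image_algebra = X.image_algebra"
  proof -
    have "Y.ev ` Collect (vars_in {0..n}) \<subseteq> X.ev ` Collect (vars_in {1..n})"
      using exists_X_of_Y unfolding Y.ev_def X.ev_def
      by (fastforce simp: Phi.proj_eq_iff X.msubst_vars Y.msubst_vars)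
    moreover have "X.ev ` Collect (vars_in {1..n}) \<subseteq> Y.ev ` Collect (vars_in {0..n})"
      using exists_Y_of_X unfolding Y.ev_def X.ev_def
      by (fastforce simp: Phi.proj_eq_iff X.msubst_vars Y.msubst_vars)
    ultimately show ?thesis
      unfolding X.image_algebra_def Y.image_algebra_def by simp
  qed
  finally have K: "K_alg K n E ends = C_alg K n E ends"
    by (simp add: C)

  have J: "J_ideal K n E ends = Idl\<^bsub>poly_algebra K {1..n}\<^esub> Jgens"
    by (simp add: J_ideal_def Jgens_def cut linform_def)
  have I: "I_ideal K n E ends = Idl\<^bsub>poly_algebra K {0..n}\<^esub> Igens"
    by (simp add: I_ideal_def Igens_def cut)
  have J_vars: "vars_in {1..n} g" if "g \<in> Jgens" for g :: "(nat, 'k) mpoly"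
    using that unfolding Jgens_def linform_def
    by (auto intro!: vars_in_power vars_in_sum simp del: power_Suc)
  have I_vars: "vars_in {0..n} g" if "g \<in> Igens" for g :: "(nat, 'k) mpoly"
    using that unfolding Igens_def
    by (auto intro!: vars_in_power vars_in_diff vars_in_prod simp del: power_Suc)
  have BC: "B_alg K n E ends \<cong>\<^sub>a\<^sub>l\<^sub>g C_alg K n E ends"
    unfolding B_alg_def J C using J_vars X_kernel_eq by (rule X.quotient_iso_image)
  have DC: "D_alg K n E ends \<cong>\<^sub>a\<^sub>l\<^sub>g C_alg K n E ends"
    unfolding D_alg_def I C XY[symmetric] using I_vars Y_kernel_eq by (rule Y.quotient_iso_image)
  \<comment> \<open>Only the isomorphism from \<open>D_alg\<close> has to be inverted; its form as a
    quotient supplies the ring laws and closure under scalars.\<close>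
  interpret D: poly_quotient K "{0..n}" Igens
    by unfold_locales (rule I_vars)
  have D: "D_alg K n E ends = D.Q"
    by (simp add: D_alg_def I D.genideal_eq D.Q_def)
  have smult: "a \<odot>\<^bsub>D.Q\<^esub> x \<in> carrier D.Q" if "x \<in> carrier D.Q" for a x
    using that by (auto simp: D.Q_ops D.Q_smult intro!: imageI vars_in_mult)
  have CD: "C_alg K n E ends \<cong>\<^sub>a\<^sub>l\<^sub>g D_alg K n E ends"
    using D.Q.ring_axioms smult DC unfolding D by (rule algebra_isomorphic_sym)
  show ?thesis
    unfolding K
    by (intro conjI BC CD DC algebra_isomorphic_refl algebra_isomorphic_trans[OF BC CD])
qed

end
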